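(* Let $T(t)$, $V(t)$ be $C_0$ semigroups on a Banach space $X$. Then the tensor product semigroup, defined on the algebraic tensor product $X\otimes X$ by $\mathcal{T}_*(t)(x\otimes y):=T(t)x\otimes V(t)y$, extends to a $C_0$ semigroup on $X\otimes_\pi X$, and the implemented semigroup $\mathcal{T}(t)P:=V^*(t)\,P\,T(t)$ is its adjoint $C_0^*$ semigroup on $\mathcal{L}(X,X^* )$, i.e. $\mathcal{T}(t)=\mathcal{T}_*(t)^*$ for all $t\ge0$.
   Context: $\mathcal{L}(X,X^* )$ is the Banach space of bounded linear operators from $X$ to its dual $X^*$. The projective tensor norm of $\rho\in X\otimes X$ is $\pi(\rho):=\inf\{\sum_i\|x_i\|\|y_i\| : \rho=\sum_i x_i\otimes y_i\}$ (finite sums), and $X\otimes_\pi X$ is the completion of $X\otimes X$ in this norm. The space $\mathcal{L}(X,X^* )$ is identified with the Banach dual $(X\otimes_\pi X)^*$ via the pairing determined by $\langle\!\langle P,x\otimes y\rangle\!\rangle:=\langle Px,y\rangle$, where $\langle\cdot,\cdot\rangle$ is the pairing between $X^*$ and $X$. A $C_0^*$ semigroup on a dual Banach space is a weak* continuous semigroup, i.e. one consisting of the adjoints of the operators of a $C_0$ semigroup on the pre-dual. *)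

theory Defs
  imports "HOL-Analysis.Analysis" "HOL-Library.Multiset"
begin

section \<open>Banach spaces over the real or the complex field\<close>

text \<open>
  The library class \<^class>\<open>banach\<close> provides real scalars only. To cover real and complex Banach
  spaces at once, the scalar field is recorded as a subset of \<^typ>\<open>complex\<close>, which is either the
  reals or everything. The value of \<open>c *\<^sub>K x\<close> is irrelevant (and never used) for \<open>c\<close> outside of
  the scalar field.
\<close>

class rc_scale =
  fixes scalars :: "'a itself \<Rightarrow> complex set"
    and scaleK :: "complex \<Rightarrow> 'a \<Rightarrow> 'a"  (infixr "*\<^sub>K" 75)

class rc_banach = banach + rc_scale +
  assumes scalars_cases: "scalars TYPE('a) = \<real> \<or> scalars TYPE('a) = UNIV"
    and scaleK_of_real: "of_real r *\<^sub>K x = r *\<^sub>R x"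
    and scaleK_scaleK: "c \<in> scalars TYPE('a) \<Longrightarrow> d \<in> scalars TYPE('a) \<Longrightarrow> c *\<^sub>K d *\<^sub>K x = (c * d) *\<^sub>K x"
    and scaleK_add_right: "c \<in> scalars TYPE('a) \<Longrightarrow> c *\<^sub>K (x + y) = c *\<^sub>K x + c *\<^sub>K y"
    and scaleK_add_left:
      "c \<in> scalars TYPE('a) \<Longrightarrow> d \<in> scalars TYPE('a) \<Longrightarrow> (c + d) *\<^sub>K x = c *\<^sub>K x + d *\<^sub>K x"
    and norm_scaleK: "c \<in> scalars TYPE('a) \<Longrightarrow> norm (c *\<^sub>K x) = cmod c * norm x"

instantiation real :: rc_banach
begin
definition scalars_real :: "real itself \<Rightarrow> complex set" where "scalars_real _ = \<real>"
definition scaleK_real :: "complex \<Rightarrow> real \<Rightarrow> real" where "scaleK_real c x = Re c * x"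
instance
  by standard
    (auto simp: scalars_real_def scaleK_real_def algebra_simps abs_mult elim!: Reals_cases)
end

instantiation complex :: rc_banach
begin
definition scalars_complex :: "complex itself \<Rightarrow> complex set" where "scalars_complex _ = UNIV"
definition scaleK_complex :: "complex \<Rightarrow> complex \<Rightarrow> complex" where "scaleK_complex c x = c * x"
instance
proof
  fix c d x y :: complex and r :: real
  show "scalars TYPE(complex) = \<real> \<or> scalars TYPE(complex) = UNIV"
    by (simp add: scalars_complex_def)
  show "of_real r *\<^sub>K x = r *\<^sub>R x"
    unfolding scaleK_complex_def by (rule scaleR_conv_of_real[symmetric])
  show "c *\<^sub>K d *\<^sub>K x = (c * d) *\<^sub>K x" "c *\<^sub>K (x + y) = c *\<^sub>K x + c *\<^sub>K y"
    "(c + d) *\<^sub>K x = c *\<^sub>K x + d *\<^sub>K x"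
    unfolding scaleK_complex_def by (simp_all only: distrib_left distrib_right mult.assoc)
  show "norm (c *\<^sub>K x) = cmod c * norm x"
    unfolding scaleK_complex_def by (rule norm_mult)
qed
end

lemma of_real_scalars [simp]: "of_real r \<in> scalars TYPE('a::rc_banach)"
  using scalars_cases[where 'a='a] Reals_of_real[of r] by (metis UNIV_I)

lemma scalars_mult:
  "c \<in> scalars TYPE('a::rc_banach) \<Longrightarrow> d \<in> scalars TYPE('a) \<Longrightarrow> c * d \<in> scalars TYPE('a)"
  using scalars_cases[where 'a='a] Reals_mult[of c d] by (metis UNIV_I)

lemma scalars_add:
  "c \<in> scalars TYPE('a::rc_banach) \<Longrightarrow> d \<in> scalars TYPE('a) \<Longrightarrow> c + d \<in> scalars TYPE('a)"
  using scalars_cases[where 'a='a] Reals_add[of c d] by (metis UNIV_I)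

lemma closed_scalars: "closed (scalars TYPE('a::rc_banach))"
  using scalars_cases[where 'a='a] closed_complex_Reals closed_UNIV by metis


section \<open>The algebraic tensor product and the projective tensor norm\<close>

text \<open>
  A multiset \<open>{#(x\<^sub>1, y\<^sub>1), \<dots>, (x\<^sub>n, y\<^sub>n)#}\<close> stands for the finite sum of the \<open>x\<^sub>i \<otimes> y\<^sub>i\<close>;
  coefficients are absorbed into the factors.
\<close>

inductive tensor_eq :: "('a::rc_banach \<times> 'a) multiset \<Rightarrow> ('a \<times> 'a) multiset \<Rightarrow> bool" where
  tensor_eq_refl: "tensor_eq m m"
| tensor_eq_sym: "tensor_eq m n \<Longrightarrow> tensor_eq n m"
| tensor_eq_trans: "tensor_eq m n \<Longrightarrow> tensor_eq n k \<Longrightarrow> tensor_eq m k"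
| tensor_eq_add: "tensor_eq m m' \<Longrightarrow> tensor_eq n n' \<Longrightarrow> tensor_eq (m + n) (m' + n')"
| tensor_eq_left: "tensor_eq {#(x + x', y)#} {#(x, y), (x', y)#}"
| tensor_eq_right: "tensor_eq {#(x, y + y')#} {#(x, y), (x, y')#}"
| tensor_eq_scale: "c \<in> scalars TYPE('a) \<Longrightarrow> tensor_eq {#(c *\<^sub>K x, y)#} {#(x, c *\<^sub>K y)#}"
| tensor_eq_zero: "tensor_eq {#(0, y)#} {#}"

lemma equivp_tensor_eq: "equivp (tensor_eq :: ('a::rc_banach \<times> 'a) multiset \<Rightarrow> _)"
proof (intro equivpI reflpI sympI transpI)
  show "tensor_eq m m" for m :: "('a \<times> 'a) multiset" by (rule tensor_eq_refl)
  show "tensor_eq n m" if "tensor_eq m n" for m n :: "('a \<times> 'a) multiset"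
    using that by (rule tensor_eq_sym)
  show "tensor_eq m k" if "tensor_eq m n" "tensor_eq n k" for m n k :: "('a \<times> 'a) multiset"
    using that by (rule tensor_eq_trans)
qed

quotient_type (overloaded) 'a tensor = "('a::rc_banach \<times> 'a) multiset" / tensor_eq
  by (rule equivp_tensor_eq)

lemma tensor_eq_scale_map:
  assumes c: "c \<in> scalars TYPE('a::rc_banach)" and "tensor_eq m (n :: ('a \<times> 'a) multiset)"
  shows "tensor_eq (image_mset (\<lambda>(x, y). (c *\<^sub>K x, y)) m) (image_mset (\<lambda>(x, y). (c *\<^sub>K x, y)) n)"
  using assms(2)
proof induction
  case (tensor_eq_refl m)
  show ?case by (rule tensor_eq.tensor_eq_refl)
next
  case (tensor_eq_sym m n)
  from tensor_eq_sym.IH show ?case by (rule tensor_eq.tensor_eq_sym)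
next
  case (tensor_eq_trans m n k)
  from tensor_eq_trans.IH show ?case by (rule tensor_eq.tensor_eq_trans)
next
  case (tensor_eq_add m m' n n')
  from tensor_eq.tensor_eq_add[OF tensor_eq_add.IH] show ?case by simp
next
  case (tensor_eq_left x x' y)
  then show ?case
    using tensor_eq.tensor_eq_left[of "c *\<^sub>K x" "c *\<^sub>K x'" y] by (simp add: scaleK_add_right[OF c])
next
  case (tensor_eq_right x y y')
  then show ?case using tensor_eq.tensor_eq_right[of "c *\<^sub>K x"] by simp
next
  case (tensor_eq_scale d x y)
  then show ?case
    using tensor_eq.tensor_eq_scale[of d "c *\<^sub>K x" y] c by (simp add: scaleK_scaleK mult.commute)
next
  case (tensor_eq_zero y)
  have "c *\<^sub>K 0 = (0::'a)" using norm_scaleK[OF c, of 0] by simp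
  then show ?case using tensor_eq.tensor_eq_zero[of y] by simp
qed

instantiation tensor :: (rc_banach) "{ab_group_add, rc_scale}"
begin

lift_definition zero_tensor :: "'a tensor" is "{#}" .

lift_definition plus_tensor :: "'a tensor \<Rightarrow> 'a tensor \<Rightarrow> 'a tensor" is "(+)"
  by (rule tensor_eq_add)

definition scalars_tensor :: "'a tensor itself \<Rightarrow> complex set"
  where "scalars_tensor _ = scalars TYPE('a)"

lift_definition scaleK_tensor :: "complex \<Rightarrow> 'a tensor \<Rightarrow> 'a tensor"
  is "\<lambda>c m. if c \<in> scalars TYPE('a) then image_mset (\<lambda>(x, y). (c *\<^sub>K x, y)) m else {#}"
  by (auto simp: tensor_eq_scale_map intro: tensor_eq_refl)

definition uminus_tensor :: "'a tensor \<Rightarrow> 'a tensor" where "- \<rho> = of_real (- 1) *\<^sub>K (\<rho> :: 'a tensor)"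

definition minus_tensor :: "'a tensor \<Rightarrow> 'a tensor \<Rightarrow> 'a tensor" where "\<rho> - \<sigma> = \<rho> + - (\<sigma> :: 'a tensor)"

lemma tensor_eq_cancel:
  "tensor_eq (image_mset (\<lambda>(x, y). (- x, y)) m + m) ({#} :: ('a \<times> 'a) multiset)"
proof (induction m)
  case empty
  then show ?case by (simp add: tensor_eq_refl)
next
  case (add p m)
  obtain x y where p: "p = (x, y)" by fastforce
  have "tensor_eq {#(- x, y), (x, y)#} {#}"
    using tensor_eq_trans[OF tensor_eq_sym[OF tensor_eq_left[of "- x" x y]]] tensor_eq_zero[of y]
    by simp
  from tensor_eq_add[OF this add] show ?case
    by (simp add: p add_mset_commute)
qed

lemma scaleK_abs_tensor:
  "c *\<^sub>K abs_tensor m =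
    abs_tensor (if c \<in> scalars TYPE('a) then image_mset (\<lambda>(x, y). (c *\<^sub>K x, y)) m else {#})"
  for m :: "('a \<times> 'a) multiset"
  by (rule scaleK_tensor.abs_eq)

instance
proof
  fix a b c :: "'a tensor"
  obtain k m n where abc: "a = abs_tensor k" "b = abs_tensor m" "c = abs_tensor n"
    by (metis Quotient_abs_rep[OF Quotient_tensor])
  show "a + b + c = a + (b + c)" "a + b = b + a" "0 + a = a"
    unfolding abc plus_tensor.abs_eq zero_tensor_def by (simp_all add: ac_simps)
  have "(\<lambda>(x, y). ((of_real (- 1) :: complex) *\<^sub>K x, y)) = (\<lambda>(x::'a, y::'a). (- x, y))"
    by (simp only: scaleK_of_real) simp
  then have "(of_real (- 1) :: complex) *\<^sub>K a + a = 0"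
    unfolding abc scaleK_abs_tensor plus_tensor.abs_eq zero_tensor_def tensor.abs_eq_iff
    using tensor_eq_cancel[of k] by (simp only: of_real_scalars if_True)
  then show "- a + a = 0" unfolding uminus_tensor_def .
  show "a - b = a + - b" by (rule minus_tensor_def)
qed

end

instantiation tensor :: (rc_banach) real_vector
begin

definition scaleR_tensor :: "real \<Rightarrow> 'a tensor \<Rightarrow> 'a tensor" where "r *\<^sub>R \<rho> = of_real r *\<^sub>K (\<rho> :: 'a tensor)"

lemma tensor_eq_scale_add:
  assumes "c \<in> scalars TYPE('a)" "d \<in> scalars TYPE('a)"
  shows "tensor_eq (image_mset (\<lambda>(x, y). ((c + d) *\<^sub>K x, y)) (m :: ('a \<times> 'a) multiset))
    (image_mset (\<lambda>(x, y). (c *\<^sub>K x, y)) m + image_mset (\<lambda>(x, y). (d *\<^sub>K x, y)) m)"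
proof (induction m)
  case empty
  then show ?case by (simp add: tensor_eq_refl)
next
  case (add p m)
  obtain x y where p: "p = (x, y)" by fastforce
  from tensor_eq_add[OF tensor_eq_left[of "c *\<^sub>K x" "d *\<^sub>K x" y] add] show ?case
    by (simp add: p scaleK_add_left[OF assms] add_mset_commute)
qed

lemma tensor_scaleK_add_right: "c *\<^sub>K (\<rho> + \<sigma>) = c *\<^sub>K \<rho> + c *\<^sub>K (\<sigma> :: 'a tensor)"
proof (induction \<rho> rule: tensor.abs_induct)
  case (1 m)
  show ?case
    by (induction \<sigma> rule: tensor.abs_induct)
      (simp add: scaleK_abs_tensor plus_tensor.abs_eq)
qed

lemma tensor_scaleK_add_left:
  assumes "c \<in> scalars TYPE('a)" "d \<in> scalars TYPE('a)"
  shows "(c + d) *\<^sub>K \<rho> = c *\<^sub>K \<rho> + d *\<^sub>K (\<rho> :: 'a tensor)"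
proof (induction \<rho> rule: tensor.abs_induct)
  case (1 m)
  then show ?case
    unfolding scaleK_abs_tensor plus_tensor.abs_eq tensor.abs_eq_iff
    using tensor_eq_scale_add[OF assms] scalars_add[OF assms] assms by simp
qed

lemma tensor_scaleK_scaleK:
  assumes "c \<in> scalars TYPE('a)" "d \<in> scalars TYPE('a)"
  shows "c *\<^sub>K d *\<^sub>K \<rho> = (c * d) *\<^sub>K (\<rho> :: 'a tensor)"
proof (induction \<rho> rule: tensor.abs_induct)
  case (1 m)
  then show ?case
    unfolding scaleK_abs_tensor using assms scalars_mult[OF assms]
    by (simp add: scaleK_scaleK[OF assms] multiset.map_comp comp_def case_prod_unfold)
qed

lemma tensor_scaleK_one: "of_real 1 *\<^sub>K \<rho> = (\<rho> :: 'a tensor)"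
proof (induction \<rho> rule: tensor.abs_induct)
  case (1 m)
  have "(of_real 1 :: complex) *\<^sub>K x = x" for x :: 'a
    by (simp only: scaleK_of_real scaleR_one)
  then show ?case
    by (simp add: scaleK_abs_tensor del: of_real_1)
qed

instance
proof
  fix a b :: real and \<rho> \<sigma> :: "'a tensor"
  show "a *\<^sub>R (\<rho> + \<sigma>) = a *\<^sub>R \<rho> + a *\<^sub>R \<sigma>"
    by (simp add: scaleR_tensor_def tensor_scaleK_add_right)
  show "(a + b) *\<^sub>R \<rho> = a *\<^sub>R \<rho> + b *\<^sub>R \<rho>"
    using tensor_scaleK_add_left[of "of_real a" "of_real b" \<rho>] by (simp add: scaleR_tensor_def)
  show "a *\<^sub>R b *\<^sub>R \<rho> = (a * b) *\<^sub>R \<rho>"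
    using tensor_scaleK_scaleK[of "of_real a" "of_real b" \<rho>] by (simp add: scaleR_tensor_def)
  show "1 *\<^sub>R \<rho> = \<rho>"
    by (simp only: scaleR_tensor_def tensor_scaleK_one)
qed

end

lift_definition tprod :: "'a::rc_banach \<Rightarrow> 'a \<Rightarrow> 'a tensor"  (infixl "\<otimes>" 70) is "\<lambda>x y. {#(x, y)#}" .

lemma tprod_add_left: "(x + x') \<otimes> y = x \<otimes> y + x' \<otimes> y"
  by transfer (simp add: tensor_eq_left add_mset_commute)

lemma tprod_add_right: "x \<otimes> (y + y') = x \<otimes> y + x \<otimes> y'"
  by transfer (simp add: tensor_eq_right add_mset_commute)

lemma tprod_scaleK_left: "c \<in> scalars TYPE('a) \<Longrightarrow> (c *\<^sub>K x) \<otimes> y = c *\<^sub>K (x \<otimes> (y::'a::rc_banach))"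
  by transfer (simp add: tensor_eq_refl)

lemma tprod_scaleK_right: "c \<in> scalars TYPE('a) \<Longrightarrow> x \<otimes> (c *\<^sub>K y) = c *\<^sub>K (x \<otimes> (y::'a::rc_banach))"
  by transfer (simp add: tensor_eq_sym[OF tensor_eq_scale])

lemma abs_tensor_eq_sum: "abs_tensor m = (\<Sum>(x, y)\<in>#m. x \<otimes> y)"
proof (induction m)
  case empty
  then show ?case by (simp add: zero_tensor_def)
next
  case (add p m)
  obtain x y where p: "p = (x, y)" by fastforce
  have "abs_tensor (add_mset p m) = x \<otimes> y + abs_tensor m"
    by (simp add: p tprod.abs_eq plus_tensor.abs_eq)
  then show ?case by (simp add: p add)
qed

lemma tensor_cases: obtains m where "\<rho> = (\<Sum>(x, y)\<in>#m. x \<otimes> y)"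
  by (metis abs_tensor_eq_sum Quotient_abs_rep[OF Quotient_tensor])

lemma tensor_induct [case_names zero tprod add]:
  assumes "P 0" "\<And>x y. P (x \<otimes> y)" "\<And>\<rho> \<sigma>. P \<rho> \<Longrightarrow> P \<sigma> \<Longrightarrow> P (\<rho> + \<sigma>)"
  shows "P \<rho>"
proof -
  have "P (\<Sum>(x, y)\<in>#m. x \<otimes> y)" for m
    by (induction m) (auto intro: assms)
  then show ?thesis using tensor_cases by metis
qed

definition proj_norm :: "'a::rc_banach tensor \<Rightarrow> real" where
  "proj_norm \<rho> = Inf {\<Sum>(x, y)\<in>#m. norm x * norm y | m. \<rho> = (\<Sum>(x, y)\<in>#m. x \<otimes> y)}"

lemma sum_mset_norm_nonneg: "0 \<le> (\<Sum>(x, y)\<in>#m. norm x * norm y)"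
  by (induction m) auto

lemma proj_norm_le: "proj_norm (\<Sum>(x, y)\<in>#m. x \<otimes> y) \<le> (\<Sum>(x, y)\<in>#m. norm x * norm y)"
  unfolding proj_norm_def
  by (rule cInf_lower) (auto intro!: bdd_belowI[of _ 0] simp: sum_mset_norm_nonneg)

lemma proj_norm_lessE:
  assumes "proj_norm \<rho> < e"
  obtains m where "\<rho> = (\<Sum>(x, y)\<in>#m. x \<otimes> y)" "(\<Sum>(x, y)\<in>#m. norm x * norm y) < e"
proof -
  have "{\<Sum>(x, y)\<in>#m. norm x * norm y | m. \<rho> = (\<Sum>(x, y)\<in>#m. x \<otimes> y)} \<noteq> {}"
    using tensor_cases[of \<rho>] by blast
  from cInf_lessD[OF this] assms that show thesis
    unfolding proj_norm_def by blast
qed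

lemma proj_norm_ge:
  assumes "\<And>m. \<rho> = (\<Sum>(x, y)\<in>#m. x \<otimes> y) \<Longrightarrow> b \<le> (\<Sum>(x, y)\<in>#m. norm x * norm y)"
  shows "b \<le> proj_norm \<rho>"
proof (rule ccontr)
  assume "\<not> b \<le> proj_norm \<rho>"
  then have "proj_norm \<rho> < b" by simp
  then obtain m where "\<rho> = (\<Sum>(x, y)\<in>#m. x \<otimes> y)" "(\<Sum>(x, y)\<in>#m. norm x * norm y) < b"
    by (rule proj_norm_lessE)
  with assms[of m] show False by simp
qed

lemma proj_norm_nonneg: "0 \<le> proj_norm \<rho>"
  by (rule proj_norm_ge) (rule sum_mset_norm_nonneg)

lemma proj_norm_tprod_le: "proj_norm (x \<otimes> y) \<le> norm x * norm y"
  using proj_norm_le[of "{#(x, y)#}"] by simp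

lemma proj_norm_zero [simp]: "proj_norm (0 :: 'a::rc_banach tensor) = 0"
  using proj_norm_le[of "{#} :: ('a \<times> 'a) multiset"] proj_norm_nonneg[of "0 :: 'a tensor"] by simp

lemma proj_norm_triangle: "proj_norm (\<rho> + \<sigma>) \<le> proj_norm \<rho> + proj_norm \<sigma>"
proof (rule field_le_epsilon)
  fix e :: real assume "e > 0"
  obtain m where m: "\<rho> = (\<Sum>(x, y)\<in>#m. x \<otimes> y)" "(\<Sum>(x, y)\<in>#m. norm x * norm y) < proj_norm \<rho> + e / 2"
    using proj_norm_lessE[of \<rho> "proj_norm \<rho> + e / 2"] \<open>e > 0\<close> by auto
  obtain n where n: "\<sigma> = (\<Sum>(x, y)\<in>#n. x \<otimes> y)" "(\<Sum>(x, y)\<in>#n. norm x * norm y) < proj_norm \<sigma> + e / 2"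
    using proj_norm_lessE[of \<sigma> "proj_norm \<sigma> + e / 2"] \<open>e > 0\<close> by auto
  from proj_norm_le[of "m + n"] m n show "proj_norm (\<rho> + \<sigma>) \<le> proj_norm \<rho> + proj_norm \<sigma> + e"
    by simp
qed

lemma proj_norm_scaleK_le:
  assumes c: "c \<in> scalars TYPE('a::rc_banach)"
  shows "proj_norm (c *\<^sub>K \<rho>) \<le> cmod c * proj_norm (\<rho> :: 'a tensor)"
proof (cases "c = 0")
  case True
  then have "c *\<^sub>K \<rho> = 0 *\<^sub>R \<rho>" by (simp add: scaleR_tensor_def del: scaleR_zero_left)
  with True show ?thesis by simp
next
  case False
  have "proj_norm (c *\<^sub>K \<rho>) / cmod c \<le> proj_norm \<rho>"
  proof (rule proj_norm_ge)
    fix m assume \<rho>: "\<rho> = (\<Sum>(x, y)\<in>#m. x \<otimes> y)"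
    have "c *\<^sub>K \<rho> = (\<Sum>(x, y)\<in>#image_mset (\<lambda>(x, y). (c *\<^sub>K x, y)) m. x \<otimes> y)"
      using c unfolding \<rho> abs_tensor_eq_sum[symmetric] by (simp add: scaleK_tensor.abs_eq)
    then have "proj_norm (c *\<^sub>K \<rho>) \<le> (\<Sum>(x, y)\<in>#image_mset (\<lambda>(x, y). (c *\<^sub>K x, y)) m. norm x * norm y)"
      using proj_norm_le by metis
    also have "\<dots> = cmod c * (\<Sum>(x, y)\<in>#m. norm x * norm y)"
      by (induction m) (auto simp: norm_scaleK[OF c] algebra_simps)
    finally show "proj_norm (c *\<^sub>K \<rho>) / cmod c \<le> (\<Sum>(x, y)\<in>#m. norm x * norm y)"
      using False by (simp add: field_simps)
  qed
  then show ?thesis using False by (simp add: field_simps)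
qed

lemma proj_norm_scaleR: "proj_norm (r *\<^sub>R \<rho>) = \<bar>r\<bar> * proj_norm \<rho>"
proof (cases "r = 0")
  case False
  have le: "proj_norm (r *\<^sub>R \<rho>) \<le> \<bar>r\<bar> * proj_norm \<rho>" for r and \<rho> :: "'a tensor"
    using proj_norm_scaleK_le[of "of_real r" \<rho>] by (simp add: scaleR_tensor_def)
  from le[of "inverse r" "r *\<^sub>R \<rho>"] False have "\<bar>r\<bar> * proj_norm \<rho> \<le> proj_norm (r *\<^sub>R \<rho>)"
    by (simp add: field_simps abs_inverse)
  with le show ?thesis by (simp add: antisym)
qed simp

lemma proj_norm_minus_commute: "proj_norm (\<rho> - \<sigma>) = proj_norm (\<sigma> - \<rho>)"
  using proj_norm_scaleR[of "-1" "\<rho> - \<sigma>"] by simp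

lemma proj_norm_triangle_diff: "proj_norm (\<rho> - \<tau>) \<le> proj_norm (\<rho> - \<sigma>) + proj_norm (\<sigma> - \<tau>)"
  using proj_norm_triangle[of "\<rho> - \<sigma>" "\<sigma> - \<tau>"] by simp

lemma proj_norm_abs_diff: "\<bar>proj_norm \<rho> - proj_norm \<sigma>\<bar> \<le> proj_norm (\<rho> - \<sigma>)"
  using proj_norm_triangle[of "\<rho> - \<sigma>" \<sigma>] proj_norm_triangle[of "\<sigma> - \<rho>" \<rho>]
    proj_norm_minus_commute[of \<rho> \<sigma>] by simp


section \<open>The projective tensor product as the completion\<close>

definition proj_Cauchy :: "(nat \<Rightarrow> 'a::rc_banach tensor) \<Rightarrow> bool" where
  "proj_Cauchy u \<longleftrightarrow> (\<forall>e>0. \<exists>M. \<forall>m\<ge>M. \<forall>n\<ge>M. proj_norm (u m - u n) < e)"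

definition ptensor_rel :: "(nat \<Rightarrow> 'a::rc_banach tensor) \<Rightarrow> (nat \<Rightarrow> 'a tensor) \<Rightarrow> bool" where
  "ptensor_rel u v \<longleftrightarrow>
    proj_Cauchy u \<and> proj_Cauchy v \<and> (\<lambda>n. proj_norm (u n - v n)) \<longlonglongrightarrow> 0"

lemma proj_Cauchy_const: "proj_Cauchy (\<lambda>_. \<rho>)"
  by (simp add: proj_Cauchy_def)

lemma proj_Cauchy_add:
  assumes "proj_Cauchy u" "proj_Cauchy v" shows "proj_Cauchy (\<lambda>n. u n + v n)"
  unfolding proj_Cauchy_def
proof (intro allI impI)
  fix e :: real assume "e > 0"
  then obtain M N where M: "\<And>m n. m \<ge> M \<Longrightarrow> n \<ge> M \<Longrightarrow> proj_norm (u m - u n) < e / 2"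
    and N: "\<And>m n. m \<ge> N \<Longrightarrow> n \<ge> N \<Longrightarrow> proj_norm (v m - v n) < e / 2"
    using assms unfolding proj_Cauchy_def by (meson half_gt_zero)
  have "proj_norm (u m + v m - (u n + v n)) < e" if "m \<ge> max M N" "n \<ge> max M N" for m n
    using proj_norm_triangle[of "u m - u n" "v m - v n"] M[of m n] N[of m n] that
    by (simp add: algebra_simps)
  then show "\<exists>M. \<forall>m\<ge>M. \<forall>n\<ge>M. proj_norm (u m + v m - (u n + v n)) < e" by blast
qed

lemma proj_norm_scaleK_diff:
  assumes "c \<in> scalars TYPE('a::rc_banach)"
  shows "proj_norm (c *\<^sub>K \<rho> - c *\<^sub>K \<sigma>) \<le> cmod c * proj_norm (\<rho> - (\<sigma> :: 'a tensor))"
proof -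
  have "c *\<^sub>K \<rho> = c *\<^sub>K (\<rho> - \<sigma>) + c *\<^sub>K \<sigma>"
    by (metis tensor_scaleK_add_right diff_add_cancel)
  then show ?thesis using proj_norm_scaleK_le[OF assms, of "\<rho> - \<sigma>"] by simp
qed

lemma proj_Cauchy_scaleK:
  assumes c: "c \<in> scalars TYPE('a::rc_banach)" and u: "proj_Cauchy (u :: nat \<Rightarrow> 'a tensor)"
  shows "proj_Cauchy (\<lambda>n. c *\<^sub>K u n)"
  unfolding proj_Cauchy_def
proof (intro allI impI)
  fix e :: real assume "e > 0"
  then have "e / (cmod c + 1) > 0"
    by (simp add: add_nonneg_pos)
  then obtain M where M: "\<And>m n. m \<ge> M \<Longrightarrow> n \<ge> M \<Longrightarrow> proj_norm (u m - u n) < e / (cmod c + 1)"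
    using u unfolding proj_Cauchy_def by meson
  have "proj_norm (c *\<^sub>K u m - c *\<^sub>K u n) < e" if "m \<ge> M" "n \<ge> M" for m n
  proof -
    have "proj_norm (c *\<^sub>K u m - c *\<^sub>K u n) \<le> cmod c * proj_norm (u m - u n)"
      by (rule proj_norm_scaleK_diff[OF c])
    also have "\<dots> \<le> (cmod c + 1) * proj_norm (u m - u n)"
      by (intro mult_right_mono proj_norm_nonneg) simp
    also have "\<dots> < e"
      using M[OF that] by (simp add: pos_less_divide_eq add_nonneg_pos mult.commute)
    finally show ?thesis .
  qed
  then show "\<exists>M. \<forall>m\<ge>M. \<forall>n\<ge>M. proj_norm (c *\<^sub>K u m - c *\<^sub>K u n) < e" by blast
qed

lemma proj_Cauchy_scaleR: "proj_Cauchy u \<Longrightarrow> proj_Cauchy (\<lambda>n. r *\<^sub>R u n)"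
  unfolding scaleR_tensor_def by (rule proj_Cauchy_scaleK) (rule of_real_scalars)

lemma ptensor_relD:
  assumes "ptensor_rel u v"
  shows "proj_Cauchy u" "proj_Cauchy v" "(\<lambda>n. proj_norm (u n - v n)) \<longlonglongrightarrow> 0"
  using assms unfolding ptensor_rel_def by blast+

lemma ptensor_relI_le:
  assumes "proj_Cauchy u" "proj_Cauchy v" "\<And>n. proj_norm (u n - v n) \<le> f n" "f \<longlonglongrightarrow> 0"
  shows "ptensor_rel u v"
proof -
  have "(\<lambda>n. proj_norm (u n - v n)) \<longlonglongrightarrow> 0"
    by (rule Lim_null_comparison[OF _ assms(4)]) (simp add: assms(3) proj_norm_nonneg)
  with assms show ?thesis by (simp add: ptensor_rel_def)
qed

lemma ptensor_rel_sym: "ptensor_rel u v \<Longrightarrow> ptensor_rel v u"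
  by (simp add: ptensor_rel_def proj_norm_minus_commute)

lemma ptensor_rel_trans:
  assumes "ptensor_rel u v" "ptensor_rel v w" shows "ptensor_rel u w"
  by (rule ptensor_relI_le[OF ptensor_relD(1)[OF assms(1)] ptensor_relD(2)[OF assms(2)]
        proj_norm_triangle_diff
        tendsto_add_zero[OF ptensor_relD(3)[OF assms(1)] ptensor_relD(3)[OF assms(2)]]])

lemma ptensor_rel_refl: "proj_Cauchy u \<Longrightarrow> ptensor_rel u u"
  by (simp add: ptensor_rel_def)

quotient_type (overloaded) 'a ptensor = "nat \<Rightarrow> 'a::rc_banach tensor" / partial: ptensor_rel
proof (rule part_equivpI)
  show "\<exists>u :: nat \<Rightarrow> 'a tensor. ptensor_rel u u"
    using ptensor_rel_refl[OF proj_Cauchy_const] by blast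
  show "symp (ptensor_rel :: (nat \<Rightarrow> 'a tensor) \<Rightarrow> _)"
    by (rule sympI) (rule ptensor_rel_sym)
  show "transp (ptensor_rel :: (nat \<Rightarrow> 'a tensor) \<Rightarrow> _)"
    by (rule transpI) (rule ptensor_rel_trans)
qed

lemma ptensor_rel_add:
  assumes u: "ptensor_rel u u'" and v: "ptensor_rel v v'"
  shows "ptensor_rel (\<lambda>n. u n + v n) (\<lambda>n. u' n + v' n)"
proof (rule ptensor_relI_le)
  show "proj_Cauchy (\<lambda>n. u n + v n)" "proj_Cauchy (\<lambda>n. u' n + v' n)"
    by (intro proj_Cauchy_add ptensor_relD[OF u] ptensor_relD[OF v])+
  show "proj_norm (u n + v n - (u' n + v' n)) \<le> proj_norm (u n - u' n) + proj_norm (v n - v' n)" for n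
    using proj_norm_triangle[of "u n - u' n" "v n - v' n"] by (simp add: algebra_simps)
  show "(\<lambda>n. proj_norm (u n - u' n) + proj_norm (v n - v' n)) \<longlonglongrightarrow> 0"
    by (rule tendsto_add_zero[OF ptensor_relD(3)[OF u] ptensor_relD(3)[OF v]])
qed

lemma ptensor_rel_scaleK:
  assumes c: "c \<in> scalars TYPE('a::rc_banach)" and uv: "ptensor_rel u (v :: nat \<Rightarrow> 'a tensor)"
  shows "ptensor_rel (\<lambda>n. c *\<^sub>K u n) (\<lambda>n. c *\<^sub>K v n)"
  by (rule ptensor_relI_le[OF proj_Cauchy_scaleK[OF c ptensor_relD(1)[OF uv]]
        proj_Cauchy_scaleK[OF c ptensor_relD(2)[OF uv]] proj_norm_scaleK_diff[OF c]
        tendsto_mult_right_zero[OF ptensor_relD(3)[OF uv]]])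

lemma proj_norm_convergent: "proj_Cauchy u \<Longrightarrow> convergent (\<lambda>n. proj_norm (u n))"
proof (rule real_Cauchy_convergent, rule CauchyI)
  fix e :: real assume "proj_Cauchy u" "e > 0"
  then obtain M where M: "\<And>m n. m \<ge> M \<Longrightarrow> n \<ge> M \<Longrightarrow> proj_norm (u m - u n) < e"
    unfolding proj_Cauchy_def by meson
  have "norm (proj_norm (u m) - proj_norm (u n)) < e" if "m \<ge> M" "n \<ge> M" for m n
    unfolding real_norm_def by (rule le_less_trans[OF proj_norm_abs_diff M[OF that]])
  then show "\<exists>M. \<forall>m\<ge>M. \<forall>n\<ge>M. norm (proj_norm (u m) - proj_norm (u n)) < e" by blast
qed

lemma proj_norm_LIMSEQ: "proj_Cauchy u \<Longrightarrow> (\<lambda>n. proj_norm (u n)) \<longlonglongrightarrow> lim (\<lambda>n. proj_norm (u n))"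
  by (simp add: proj_norm_convergent convergent_LIMSEQ_iff[symmetric])

lemma ptensor_rel_lim:
  assumes "ptensor_rel u v" shows "lim (\<lambda>n. proj_norm (u n)) = lim (\<lambda>n. proj_norm (v n))"
proof -
  have "(\<lambda>n. proj_norm (u n) - proj_norm (v n)) \<longlonglongrightarrow> 0"
    by (rule Lim_null_comparison[OF _ ptensor_relD(3)[OF assms]]) (simp add: proj_norm_abs_diff)
  moreover have "(\<lambda>n. proj_norm (u n) - proj_norm (v n)) \<longlonglongrightarrow>
      lim (\<lambda>n. proj_norm (u n)) - lim (\<lambda>n. proj_norm (v n))"
    by (intro tendsto_diff proj_norm_LIMSEQ ptensor_relD[OF assms])
  ultimately have "lim (\<lambda>n. proj_norm (u n)) - lim (\<lambda>n. proj_norm (v n)) = 0"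
    by (rule LIMSEQ_unique[rotated])
  then show ?thesis by simp
qed

instantiation ptensor :: (rc_banach) "{real_vector, rc_scale}"
begin

lift_definition zero_ptensor :: "'a ptensor" is "\<lambda>_. 0"
  by (rule ptensor_rel_refl[OF proj_Cauchy_const])

lift_definition plus_ptensor :: "'a ptensor \<Rightarrow> 'a ptensor \<Rightarrow> 'a ptensor" is "\<lambda>u v n. u n + v n"
  by (rule ptensor_rel_add)

lift_definition scaleR_ptensor :: "real \<Rightarrow> 'a ptensor \<Rightarrow> 'a ptensor" is "\<lambda>r u n. r *\<^sub>R u n"
  unfolding scaleR_tensor_def by (rule ptensor_rel_scaleK[OF of_real_scalars])

definition uminus_ptensor :: "'a ptensor \<Rightarrow> 'a ptensor" where "- z = (- 1) *\<^sub>R (z :: 'a ptensor)"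

definition minus_ptensor :: "'a ptensor \<Rightarrow> 'a ptensor \<Rightarrow> 'a ptensor"
  where "z - w = z + - (w :: 'a ptensor)"

definition scalars_ptensor :: "'a ptensor itself \<Rightarrow> complex set"
  where "scalars_ptensor _ = scalars TYPE('a)"

lift_definition scaleK_ptensor :: "complex \<Rightarrow> 'a ptensor \<Rightarrow> 'a ptensor"
  is "\<lambda>c u n. if c \<in> scalars TYPE('a) then c *\<^sub>K u n else 0"
  subgoal for c u v
    by (cases "c \<in> scalars TYPE('a)")
      (simp_all add: ptensor_rel_scaleK ptensor_rel_refl[OF proj_Cauchy_const])
  done

lemma ptensor_repE:
  obtains u where "proj_Cauchy u" "(z :: 'a ptensor) = abs_ptensor u"
  by (metis Quotient_abs_rep[OF Quotient_ptensor] Quotient_rep_reflp[OF Quotient_ptensor]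
      ptensor_relD(1))

lemma plus_abs_ptensor:
  "proj_Cauchy u \<Longrightarrow> proj_Cauchy v \<Longrightarrow>
    abs_ptensor u + abs_ptensor v = (abs_ptensor (\<lambda>n. u n + v n) :: 'a ptensor)"
  by (rule plus_ptensor.abs_eq) (simp_all add: ptensor_rel_refl)

lemma scaleR_abs_ptensor:
  "proj_Cauchy u \<Longrightarrow> r *\<^sub>R abs_ptensor u = (abs_ptensor (\<lambda>n. r *\<^sub>R u n) :: 'a ptensor)"
  by (rule scaleR_ptensor.abs_eq) (simp add: ptensor_rel_refl)

lemma scaleK_abs_ptensor:
  assumes "c \<in> scalars TYPE('a)" "proj_Cauchy u"
  shows "c *\<^sub>K abs_ptensor u = (abs_ptensor (\<lambda>n. c *\<^sub>K u n) :: 'a ptensor)"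
  using scaleK_ptensor.abs_eq[of u c] assms by (simp add: ptensor_rel_refl)

instance
proof
  fix a b c :: "'a ptensor" and r s :: real
  obtain u v w where C: "proj_Cauchy u" "proj_Cauchy v" "proj_Cauchy w"
    and abc: "a = abs_ptensor u" "b = abs_ptensor v" "c = abs_ptensor w"
    using ptensor_repE by metis
  have zero: "0 = (abs_ptensor (\<lambda>_. 0) :: 'a ptensor)" unfolding zero_ptensor_def ..
  note s = plus_abs_ptensor scaleR_abs_ptensor C proj_Cauchy_add proj_Cauchy_scaleR
    proj_Cauchy_const
  show "a + b + c = a + (b + c)" "a + b = b + a"
    by (simp_all add: abc s ac_simps)
  show "0 + a = a" by (simp add: abc zero s)
  show "- a + a = 0"
    unfolding uminus_ptensor_def abc scaleR_abs_ptensor[OF C(1)]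
      plus_abs_ptensor[OF proj_Cauchy_scaleR[OF C(1)] C(1)] by (simp add: zero)
  show "a - b = a + - b" by (rule minus_ptensor_def)
  show "r *\<^sub>R (a + b) = r *\<^sub>R a + r *\<^sub>R b"
    by (simp add: abc s scaleR_add_right)
  show "(r + s) *\<^sub>R a = r *\<^sub>R a + s *\<^sub>R a"
    by (simp add: abc s scaleR_add_left)
  show "r *\<^sub>R s *\<^sub>R a = (r * s) *\<^sub>R a" "1 *\<^sub>R a = a"
    by (simp_all add: abc s)
qed

end

instantiation ptensor :: (rc_banach) real_normed_vector
begin

lift_definition norm_ptensor :: "'a ptensor \<Rightarrow> real" is "\<lambda>u. lim (\<lambda>n. proj_norm (u n))"
  by (rule ptensor_rel_lim)

lemma norm_abs_ptensor: "proj_Cauchy u \<Longrightarrow> norm (abs_ptensor u :: 'a ptensor) = lim (\<lambda>n. proj_norm (u n))"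
  by (rule norm_ptensor.abs_eq) (simp add: ptensor_rel_refl)

lemma norm_ptensor_LIMSEQ: "proj_Cauchy u \<Longrightarrow> (\<lambda>n. proj_norm (u n)) \<longlonglongrightarrow> norm (abs_ptensor u :: 'a ptensor)"
  by (simp add: norm_abs_ptensor proj_norm_LIMSEQ)

definition dist_ptensor :: "'a ptensor \<Rightarrow> 'a ptensor \<Rightarrow> real" where "dist_ptensor z w = norm (z - w)"

definition sgn_ptensor :: "'a ptensor \<Rightarrow> 'a ptensor" where "sgn_ptensor z = z /\<^sub>R norm z"

definition uniformity_ptensor :: "('a ptensor \<times> 'a ptensor) filter"
  where "uniformity_ptensor = (INF e\<in>{0 <..}. principal {(z, w). dist z w < e})"

definition open_ptensor :: "'a ptensor set \<Rightarrow> bool"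
  where "open_ptensor S = (\<forall>z\<in>S. \<forall>\<^sub>F (z', w) in uniformity. z' = z \<longrightarrow> w \<in> S)"

instance
proof
  fix z w :: "'a ptensor" and r :: real
  obtain u v where C: "proj_Cauchy u" "proj_Cauchy v" and zw: "z = abs_ptensor u" "w = abs_ptensor v"
    using ptensor_repE by metis
  show "dist z w = norm (z - w)" by (rule dist_ptensor_def)
  show "sgn z = z /\<^sub>R norm z" by (rule sgn_ptensor_def)
  show "(uniformity :: ('a ptensor \<times> 'a ptensor) filter)
      = (INF e\<in>{0 <..}. principal {(z, w). dist z w < e})"
    by (rule uniformity_ptensor_def)
  show "open S \<longleftrightarrow> (\<forall>z\<in>S. \<forall>\<^sub>F (z', w) in uniformity. z' = z \<longrightarrow> w \<in> S)" for S :: "'a ptensor set"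
    by (rule open_ptensor_def)
  have "z = 0 \<longleftrightarrow> ptensor_rel u (\<lambda>_. 0)"
    unfolding zw zero_ptensor_def
    using Quotient_rel[OF Quotient_ptensor, of u "\<lambda>_. 0"] C
    by (simp add: ptensor_rel_refl proj_Cauchy_const)
  also have "\<dots> \<longleftrightarrow> (\<lambda>n. proj_norm (u n)) \<longlonglongrightarrow> 0"
    using C by (simp add: ptensor_rel_def proj_Cauchy_const)
  also have "\<dots> \<longleftrightarrow> norm z = 0"
    using norm_ptensor_LIMSEQ[OF C(1)] LIMSEQ_unique zw(1) by fastforce
  finally show "norm z = 0 \<longleftrightarrow> z = 0" by simp
  show "norm (z + w) \<le> norm z + norm w"
    unfolding zw plus_abs_ptensor[OF C]
    by (rule LIMSEQ_le[OF norm_ptensor_LIMSEQ[OF proj_Cauchy_add[OF C]]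
          tendsto_add[OF norm_ptensor_LIMSEQ[OF C(1)] norm_ptensor_LIMSEQ[OF C(2)]]])
      (simp add: proj_norm_triangle)
  have "(\<lambda>n. \<bar>r\<bar> * proj_norm (u n)) \<longlonglongrightarrow> \<bar>r\<bar> * norm z"
    unfolding zw by (intro tendsto_mult tendsto_const norm_ptensor_LIMSEQ C)
  moreover have "(\<lambda>n. \<bar>r\<bar> * proj_norm (u n)) \<longlonglongrightarrow> norm (r *\<^sub>R z)"
    using norm_ptensor_LIMSEQ[OF proj_Cauchy_scaleR[OF C(1), of r]]
    unfolding zw scaleR_abs_ptensor[OF C(1)] by (simp add: proj_norm_scaleR)
  ultimately show "norm (r *\<^sub>R z) = \<bar>r\<bar> * norm z" by (rule LIMSEQ_unique[rotated])
qed

end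

definition of_tensor :: "'a::rc_banach tensor \<Rightarrow> 'a ptensor" where
  "of_tensor \<rho> = abs_ptensor (\<lambda>_. \<rho>)"

lemma of_tensor_add: "of_tensor (\<rho> + \<sigma>) = of_tensor \<rho> + of_tensor \<sigma>"
  by (simp add: of_tensor_def plus_abs_ptensor proj_Cauchy_const)

lemma of_tensor_scaleR: "of_tensor (r *\<^sub>R \<rho>) = r *\<^sub>R of_tensor \<rho>"
  by (simp add: of_tensor_def scaleR_abs_ptensor proj_Cauchy_const)

lemma of_tensor_scaleK:
  "c \<in> scalars TYPE('a::rc_banach) \<Longrightarrow> of_tensor (c *\<^sub>K \<rho>) = c *\<^sub>K of_tensor (\<rho> :: 'a tensor)"
  by (simp add: of_tensor_def scaleK_abs_ptensor proj_Cauchy_const)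

lemma linear_of_tensor: "linear of_tensor"
  by (rule linearI) (simp_all add: of_tensor_add of_tensor_scaleR)

lemma norm_of_tensor: "norm (of_tensor \<rho>) = proj_norm \<rho>"
  unfolding of_tensor_def norm_abs_ptensor[OF proj_Cauchy_const] by (rule limI) (rule tendsto_const)

lemma of_tensor_LIMSEQ:
  assumes u: "proj_Cauchy u"
  shows "(\<lambda>k. of_tensor (u k)) \<longlonglongrightarrow> abs_ptensor u"
proof (rule LIMSEQ_I)
  fix e :: real assume "e > 0"
  then have "e / 2 > 0" by simp
  then obtain M where M: "\<And>m n. m \<ge> M \<Longrightarrow> n \<ge> M \<Longrightarrow> proj_norm (u m - u n) < e / 2"
    using u unfolding proj_Cauchy_def by meson
  have "norm (of_tensor (u k) - abs_ptensor u) < e" if "k \<ge> M" for k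
  proof -
    have C: "proj_Cauchy (\<lambda>n. u k + (- 1) *\<^sub>R u n)"
      by (intro proj_Cauchy_add proj_Cauchy_const proj_Cauchy_scaleR u)
    have eq: "of_tensor (u k) - abs_ptensor u = abs_ptensor (\<lambda>n. u k + (- 1) *\<^sub>R u n)"
      unfolding minus_ptensor_def uminus_ptensor_def of_tensor_def scaleR_abs_ptensor[OF u]
      by (rule plus_abs_ptensor[OF proj_Cauchy_const proj_Cauchy_scaleR[OF u]])
    have "norm (of_tensor (u k) - abs_ptensor u) \<le> e / 2"
      unfolding eq
    proof (rule LIMSEQ_le_const2[OF norm_ptensor_LIMSEQ[OF C]], intro exI allI impI)
      fix n assume "M \<le> n"
      then show "proj_norm (u k + (- 1) *\<^sub>R u n) \<le> e / 2"
        using M[OF that, of n] by simp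
    qed
    with \<open>e > 0\<close> show ?thesis by simp
  qed
  then show "\<exists>M. \<forall>k\<ge>M. norm (of_tensor (u k) - abs_ptensor u) < e" by blast
qed

lemma of_tensor_approx:
  fixes z :: "'a::rc_banach ptensor"
  obtains u where "proj_Cauchy u" "(\<lambda>n. of_tensor (u n)) \<longlonglongrightarrow> z"
  by (metis ptensor_repE of_tensor_LIMSEQ)

lemma of_tensor_dense: "closure (range of_tensor) = (UNIV :: 'a::rc_banach ptensor set)"
proof (intro equalityI subset_UNIV subsetI)
  fix z :: "'a ptensor"
  obtain u where "(\<lambda>n. of_tensor (u n)) \<longlonglongrightarrow> z" by (rule of_tensor_approx)
  then show "z \<in> closure (range of_tensor)"
    unfolding closure_sequential by (intro exI[of _ "\<lambda>n. of_tensor (u n)"]) simp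
qed

instance ptensor :: (rc_banach) banach
proof
  fix X :: "nat \<Rightarrow> 'a ptensor" assume X: "Cauchy X"
  have "\<exists>\<rho>. norm (X k - of_tensor \<rho>) < inverse (real (Suc k))" for k
  proof -
    obtain u where "(\<lambda>n. of_tensor (u n)) \<longlonglongrightarrow> X k" by (rule of_tensor_approx)
    from LIMSEQ_D[OF this, of "inverse (real (Suc k))"]
    obtain n where "norm (of_tensor (u n) - X k) < inverse (real (Suc k))" by auto
    then have "norm (X k - of_tensor (u n)) < inverse (real (Suc k))"
      by (simp only: norm_minus_commute)
    then show ?thesis by blast
  qed
  then obtain \<rho> where \<rho>: "\<And>k. norm (X k - of_tensor (\<rho> k)) < inverse (real (Suc k))"
    by metis
  have "(\<lambda>k. X k - of_tensor (\<rho> k)) \<longlonglongrightarrow> 0"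
    by (rule Lim_null_comparison[OF always_eventually LIMSEQ_inverse_real_of_nat])
      (intro allI less_imp_le \<rho>)
  then have d: "(\<lambda>k. of_tensor (\<rho> k) - X k) \<longlonglongrightarrow> 0"
    using tendsto_minus by fastforce
  have "Cauchy (\<lambda>k. (of_tensor (\<rho> k) - X k) + X k)"
  proof (rule CauchyI)
    fix e :: real assume "e > 0"
    then have e: "e / 2 > 0" by simp
    obtain M where M: "\<And>m n. m \<ge> M \<Longrightarrow> n \<ge> M \<Longrightarrow> norm (X m - X n) < e / 2"
      using CauchyD[OF X e] by meson
    obtain N where N: "\<And>m n. m \<ge> N \<Longrightarrow> n \<ge> N \<Longrightarrow>
        norm ((of_tensor (\<rho> m) - X m) - (of_tensor (\<rho> n) - X n)) < e / 2"
      using CauchyD[OF LIMSEQ_imp_Cauchy[OF d] e] by meson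
    have "norm ((of_tensor (\<rho> m) - X m + X m) - (of_tensor (\<rho> n) - X n + X n)) < e"
      if "m \<ge> max M N" "n \<ge> max M N" for m n
      using norm_triangle_ineq[of "X m - X n" "(of_tensor (\<rho> m) - X m) - (of_tensor (\<rho> n) - X n)"]
        M[of m n] N[of m n] that by simp
    then show "\<exists>M. \<forall>m\<ge>M. \<forall>n\<ge>M.
        norm ((of_tensor (\<rho> m) - X m + X m) - (of_tensor (\<rho> n) - X n + X n)) < e"
      by blast
  qed
  then have C: "Cauchy (\<lambda>k. of_tensor (\<rho> k))" by simp
  have "proj_Cauchy \<rho>"
    unfolding proj_Cauchy_def
    using C by (simp add: Cauchy_iff linear_diff[OF linear_of_tensor, symmetric] norm_of_tensor)
  from tendsto_diff[OF of_tensor_LIMSEQ[OF this] d] show "convergent X"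
    by (auto simp: convergent_def)
qed

instance ptensor :: (rc_banach) rc_banach
proof
  fix x y :: "'a ptensor" and c d :: complex and r :: real
  obtain u v where C: "proj_Cauchy u" "proj_Cauchy v" and xy: "x = abs_ptensor u" "y = abs_ptensor v"
    using ptensor_repE by metis
  have sc: "scalars TYPE('a ptensor) = scalars TYPE('a)" by (rule scalars_ptensor_def)
  show "scalars TYPE('a ptensor) = \<real> \<or> scalars TYPE('a ptensor) = UNIV"
    unfolding sc by (rule scalars_cases)
  show "of_real r *\<^sub>K x = r *\<^sub>R x"
    by (simp add: xy scaleK_abs_ptensor scaleR_abs_ptensor C scaleR_tensor_def)
  show "c *\<^sub>K d *\<^sub>K x = (c * d) *\<^sub>K x"
    if "c \<in> scalars TYPE('a ptensor)" "d \<in> scalars TYPE('a ptensor)"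
    using that[unfolded sc]
    by (simp add: xy scaleK_abs_ptensor C proj_Cauchy_scaleK scalars_mult tensor_scaleK_scaleK)
  show "(c + d) *\<^sub>K x = c *\<^sub>K x + d *\<^sub>K x"
    if "c \<in> scalars TYPE('a ptensor)" "d \<in> scalars TYPE('a ptensor)"
    using that[unfolded sc]
    by (simp add: xy scaleK_abs_ptensor plus_abs_ptensor C proj_Cauchy_scaleK scalars_add
        tensor_scaleK_add_left)
  show "c *\<^sub>K (x + y) = c *\<^sub>K x + c *\<^sub>K y" if "c \<in> scalars TYPE('a ptensor)"
    using that[unfolded sc]
    by (simp add: xy scaleK_abs_ptensor plus_abs_ptensor C proj_Cauchy_scaleK proj_Cauchy_add
        tensor_scaleK_add_right)
  show "norm (c *\<^sub>K x) = cmod c * norm x" if "c \<in> scalars TYPE('a ptensor)"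
  proof -
    have c: "c \<in> scalars TYPE('a)" using that[unfolded sc] .
    have eq: "proj_norm (c *\<^sub>K \<rho>) = cmod c * proj_norm \<rho>" for \<rho> :: "'a tensor"
    proof (cases "c = 0")
      case True
      then show ?thesis
        using proj_norm_scaleK_le[OF c, of \<rho>] proj_norm_nonneg[of "c *\<^sub>K \<rho>"] by simp
    next
      case False
      have ci: "inverse c \<in> scalars TYPE('a)"
        using scalars_cases[where 'a='a] c Reals_inverse[of c] by (metis UNIV_I)
      have "inverse c *\<^sub>K c *\<^sub>K \<rho> = \<rho>"
        using tensor_scaleK_scaleK[OF ci c, of \<rho>] tensor_scaleK_one[of \<rho>] False by simp
      then have "proj_norm \<rho> \<le> inverse (cmod c) * proj_norm (c *\<^sub>K \<rho>)"
        using proj_norm_scaleK_le[OF ci, of "c *\<^sub>K \<rho>"] by (simp add: norm_inverse)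
      then have "cmod c * proj_norm \<rho> \<le> proj_norm (c *\<^sub>K \<rho>)"
        using False by (simp add: field_simps)
      with proj_norm_scaleK_le[OF c, of \<rho>] show ?thesis by simp
    qed
    have "(\<lambda>n. cmod c * proj_norm (u n)) \<longlonglongrightarrow> cmod c * norm x"
      unfolding xy by (intro tendsto_mult tendsto_const norm_ptensor_LIMSEQ C)
    moreover have "(\<lambda>n. cmod c * proj_norm (u n)) \<longlonglongrightarrow> norm (c *\<^sub>K x)"
      using norm_ptensor_LIMSEQ[OF proj_Cauchy_scaleK[OF c C(1)]]
      unfolding xy scaleK_abs_ptensor[OF c C(1)] by (simp add: eq)
    ultimately show ?thesis by (rule LIMSEQ_unique[rotated])
  qed
qed


section \<open>Linear maps out of the tensor products\<close>

text \<open>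
  For \<open>B\<close> bilinear over the scalar field, the value does not depend on the chosen representation
  of \<open>\<rho>\<close> as a finite sum, see \<open>tensor_lift_sum\<close> below.
\<close>

definition tensor_lift :: "('a::rc_banach \<Rightarrow> 'a \<Rightarrow> 'c::ab_group_add) \<Rightarrow> 'a tensor \<Rightarrow> 'c" where
  "tensor_lift B \<rho> = (\<Sum>(x, y)\<in>#(SOME m. \<rho> = (\<Sum>(x, y)\<in>#m. x \<otimes> y)). B x y)"

definition balanced :: "('a::rc_banach \<Rightarrow> 'a \<Rightarrow> 'c::ab_group_add) \<Rightarrow> bool" where
  "balanced B \<longleftrightarrow>
    (\<forall>x x' y. B (x + x') y = B x y + B x' y) \<and>
    (\<forall>x y y'. B x (y + y') = B x y + B x y') \<and>
    (\<forall>c\<in>scalars TYPE('a). \<forall>x y. B (c *\<^sub>K x) y = B x (c *\<^sub>K y))"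

lemma balanced_tensor_eq:
  assumes B: "balanced B" and "tensor_eq m n"
  shows "(\<Sum>(x, y)\<in>#m. B x y) = (\<Sum>(x, y)\<in>#n. B x y)"
  using assms(2)
proof induction
  case (tensor_eq_trans m n k)
  from tensor_eq_trans.IH show ?case by (rule trans)
next
  case (tensor_eq_sym m n)
  from tensor_eq_sym.IH show ?case by (rule sym)
next
  case (tensor_eq_add m m' n n')
  from tensor_eq_add.IH show ?case by simp
next
  case (tensor_eq_zero y)
  have "B (0 + 0) y = B 0 y + B 0 y" using B unfolding balanced_def by blast
  then show ?case by simp
next
  case (tensor_eq_left x x' y)
  have "B (x + x') y = B x y + B x' y" using B unfolding balanced_def by blast
  then show ?case by simp
next
  case (tensor_eq_right x y y')
  have "B x (y + y') = B x y + B x y'" using B unfolding balanced_def by blast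
  then show ?case by simp
next
  case (tensor_eq_scale c x y)
  then have "B (c *\<^sub>K x) y = B x (c *\<^sub>K y)" using B unfolding balanced_def by blast
  then show ?case by simp
qed (rule refl)

lemma tensor_lift_sum:
  assumes "balanced B"
  shows "tensor_lift B (\<Sum>(x, y)\<in>#m. x \<otimes> y) = (\<Sum>(x, y)\<in>#m. B x y)"
proof -
  define n where "n = (SOME n. (\<Sum>(x, y)\<in>#m. x \<otimes> y) = (\<Sum>(x, y)\<in>#n. x \<otimes> y))"
  have "(\<Sum>(x, y)\<in>#m. x \<otimes> y) = (\<Sum>(x, y)\<in>#n. x \<otimes> y)"
    unfolding n_def by (rule someI) (rule refl)
  then have "tensor_eq n m"
    unfolding abs_tensor_eq_sum[symmetric] tensor.abs_eq_iff[symmetric] by (rule sym)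
  from balanced_tensor_eq[OF assms this] show ?thesis
    unfolding tensor_lift_def n_def .
qed

lemma tensor_lift_tprod: "balanced B \<Longrightarrow> tensor_lift B (x \<otimes> y) = B x y"
  using tensor_lift_sum[of B "{#(x, y)#}"] by simp

lemma tensor_lift_add:
  assumes "balanced B" shows "tensor_lift B (\<rho> + \<sigma>) = tensor_lift B \<rho> + tensor_lift B \<sigma>"
proof -
  obtain m where m: "\<rho> = (\<Sum>(x, y)\<in>#m. x \<otimes> y)" by (rule tensor_cases)
  obtain n where n: "\<sigma> = (\<Sum>(x, y)\<in>#n. x \<otimes> y)" by (rule tensor_cases)
  show ?thesis
    using tensor_lift_sum[OF assms, of "m + n"] tensor_lift_sum[OF assms, of m]
      tensor_lift_sum[OF assms, of n] by (simp add: m n)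
qed

lemma tensor_lift_scaleK:
  assumes B: "balanced B" and c: "c \<in> scalars TYPE('a::rc_banach)"
    and f: "f 0 = 0" "\<And>a b. f (a + b) = f a + f b" and Bf: "\<And>x y. B (c *\<^sub>K x) y = f (B x y)"
  shows "tensor_lift B (c *\<^sub>K \<rho>) = f (tensor_lift B (\<rho> :: 'a tensor))"
proof (induction \<rho> rule: tensor_induct)
  case zero
  have "tensor_lift B (0 :: 'a tensor) = 0" using tensor_lift_sum[OF B, of "{#}"] by simp
  moreover have "c *\<^sub>K (0 :: 'a tensor) = 0" using tensor_scaleK_add_right[of c 0 0] by simp
  ultimately show ?case using f by simp
next
  case (tprod x y)
  show ?case using Bf[of x y] tensor_lift_tprod[OF B] by (metis tprod_scaleK_left[OF c])
next
  case (add \<rho> \<sigma>)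
  then show ?case by (simp only: tensor_scaleK_add_right tensor_lift_add[OF B] f)
qed

lemma ptensor_extend:
  fixes f :: "'a::rc_banach tensor \<Rightarrow> 'c::banach"
  assumes f: "linear f" and bound: "\<And>\<rho>. norm (f \<rho>) \<le> C * proj_norm \<rho>"
  obtains g :: "'a ptensor \<Rightarrow>\<^sub>L 'c" where "\<And>\<rho>. g (of_tensor \<rho>) = f \<rho>"
proof -
  have diff: "norm (f \<rho> - f \<sigma>) \<le> C * norm (of_tensor \<rho> - of_tensor \<sigma>)" for \<rho> \<sigma>
    using bound[of "\<rho> - \<sigma>"]
    by (simp add: linear_diff[OF f] norm_of_tensor[symmetric] linear_diff[OF linear_of_tensor])
  have "\<exists>u. (\<lambda>n. of_tensor (u n)) \<longlonglongrightarrow> z" for z :: "'a ptensor"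
    using of_tensor_approx[of z] by blast
  then obtain r where r: "\<And>z :: 'a ptensor. (\<lambda>n. of_tensor (r z n)) \<longlonglongrightarrow> z" by metis
  define g where "g z = lim (\<lambda>n. f (r z n))" for z
  have Cz: "convergent (\<lambda>n. f (r z n))" for z
  proof (rule Cauchy_convergent)
    have "Cauchy (\<lambda>n. of_tensor (r z n))" by (rule LIMSEQ_imp_Cauchy[OF r])
    show "Cauchy (\<lambda>n. f (r z n))"
    proof (rule CauchyI)
      fix e :: real assume "e > 0"
      then have "e / (\<bar>C\<bar> + 1) > 0" by (simp add: add_nonneg_pos)
      then obtain M where M: "\<And>m n. m \<ge> M \<Longrightarrow> n \<ge> M \<Longrightarrow>
          norm (of_tensor (r z m) - of_tensor (r z n)) < e / (\<bar>C\<bar> + 1)"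
        using CauchyD[OF \<open>Cauchy (\<lambda>n. of_tensor (r z n))\<close>] by meson
      have "norm (f (r z m) - f (r z n)) < e" if "m \<ge> M" "n \<ge> M" for m n
      proof -
        have "norm (f (r z m) - f (r z n)) \<le> C * norm (of_tensor (r z m) - of_tensor (r z n))"
          by (rule diff)
        also have "\<dots> \<le> (\<bar>C\<bar> + 1) * norm (of_tensor (r z m) - of_tensor (r z n))"
          by (intro mult_right_mono) auto
        also have "\<dots> < e" using M[OF that] by (simp add: pos_less_divide_eq add_nonneg_pos mult.commute)
        finally show ?thesis .
      qed
      then show "\<exists>M. \<forall>m\<ge>M. \<forall>n\<ge>M. norm (f (r z m) - f (r z n)) < e" by blast
    qed
  qed
  have g: "(\<lambda>n. f (u n)) \<longlonglongrightarrow> g z" if u: "(\<lambda>n. of_tensor (u n)) \<longlonglongrightarrow> z" for u z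
  proof -
    have "(\<lambda>n. norm (of_tensor (u n) - of_tensor (r z n))) \<longlonglongrightarrow> norm (z - z)"
      by (intro tendsto_norm tendsto_diff u r)
    then have "(\<lambda>n. C * norm (of_tensor (u n) - of_tensor (r z n))) \<longlonglongrightarrow> 0"
      by (intro tendsto_mult_right_zero) simp
    then have "(\<lambda>n. f (u n) - f (r z n)) \<longlonglongrightarrow> 0"
      by (rule Lim_null_comparison[rotated]) (simp add: diff)
    moreover have "(\<lambda>n. f (r z n)) \<longlonglongrightarrow> g z"
      using Cz unfolding g_def by (simp add: convergent_LIMSEQ_iff)
    ultimately have "(\<lambda>n. (f (u n) - f (r z n)) + f (r z n)) \<longlonglongrightarrow> 0 + g z"
      by (rule tendsto_add)
    then show ?thesis by simp
  qed
  have "bounded_linear g"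
  proof (rule bounded_linear_intro)
    fix x y :: "'a ptensor" and a :: real
    have "(\<lambda>n. of_tensor (r x n + r y n)) \<longlonglongrightarrow> x + y"
      unfolding of_tensor_add by (intro tendsto_add r)
    from g[OF this] have "(\<lambda>n. f (r x n) + f (r y n)) \<longlonglongrightarrow> g (x + y)"
      by (simp add: linear_add[OF f])
    with tendsto_add[OF g[OF r] g[OF r]] show "g (x + y) = g x + g y"
      by (rule LIMSEQ_unique[rotated])
    have "(\<lambda>n. of_tensor (a *\<^sub>R r x n)) \<longlonglongrightarrow> a *\<^sub>R x"
      unfolding of_tensor_scaleR by (intro tendsto_scaleR tendsto_const r)
    from g[OF this] have "(\<lambda>n. a *\<^sub>R f (r x n)) \<longlonglongrightarrow> g (a *\<^sub>R x)"
      by (simp add: linear_scale[OF f])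
    with tendsto_scaleR[OF tendsto_const g[OF r]] show "g (a *\<^sub>R x) = a *\<^sub>R g x"
      by (rule LIMSEQ_unique[rotated])
    show "norm (g x) \<le> norm x * C"
    proof (rule LIMSEQ_le)
      show "(\<lambda>n. norm (f (r x n))) \<longlonglongrightarrow> norm (g x)" by (intro tendsto_norm g r)
      show "(\<lambda>n. norm (of_tensor (r x n)) * C) \<longlonglongrightarrow> norm x * C"
        by (intro tendsto_mult tendsto_norm tendsto_const r)
      show "\<exists>N. \<forall>n\<ge>N. norm (f (r x n)) \<le> norm (of_tensor (r x n)) * C"
        using bound by (simp add: norm_of_tensor mult.commute)
    qed
  qed
  then obtain h where h: "blinfun_apply h = g"
    using bounded_linear_Blinfun_apply by blast
  have "h (of_tensor \<rho>) = f \<rho>" for \<rho>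
    using g[of "\<lambda>_. \<rho>" "of_tensor \<rho>"] h by (simp add: LIMSEQ_const_iff)
  then show thesis by (rule that)
qed

lemma ptensor_eqI:
  fixes f g :: "'a::rc_banach ptensor \<Rightarrow>\<^sub>L 'c::real_normed_vector"
  assumes "\<And>x y. f (of_tensor (x \<otimes> y)) = g (of_tensor (x \<otimes> y))"
  shows "f = g"
proof (rule blinfun_eqI)
  fix z :: "'a ptensor"
  have zero: "of_tensor (0 :: 'a tensor) = 0" by (rule linear_0[OF linear_of_tensor])
  have eq: "f (of_tensor \<rho>) = g (of_tensor \<rho>)" for \<rho>
    by (induction \<rho> rule: tensor_induct) (simp_all add: zero assms of_tensor_add blinfun.add_right)
  obtain u where u: "(\<lambda>n. of_tensor (u n)) \<longlonglongrightarrow> z" by (rule of_tensor_approx)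
  have "(\<lambda>n. f (of_tensor (u n))) \<longlonglongrightarrow> f z" "(\<lambda>n. g (of_tensor (u n))) \<longlonglongrightarrow> g z"
    by (intro blinfun.tendsto tendsto_const u)+
  then show "f z = g z" unfolding eq by (rule LIMSEQ_unique)
qed


section \<open>Operators, duals, and the pairing with the projective tensor product\<close>

text \<open>
  \<^typ>\<open>'a \<Rightarrow>\<^sub>L 'b\<close> is the type of real-linear bounded maps, so homogeneity over the scalar field is
  added. If the scalar field is real, functionals are real-valued functions into \<^typ>\<open>complex\<close>.
  The bounded operators \<open>X \<rightarrow> X\<^sup>*\<close> are the elements \<open>P\<close> of \<open>ops_to_dual\<close>, with \<open>P x y\<close> being
  \<open>\<langle>P x, y\<rangle>\<close>; all duality pairings are bilinear.
\<close>

definition bounded_ops :: "('a::rc_banach \<Rightarrow>\<^sub>L 'a) set" where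
  "bounded_ops = {A :: 'a \<Rightarrow>\<^sub>L 'a. \<forall>c\<in>scalars TYPE('a). \<forall>x. A (c *\<^sub>K x) = c *\<^sub>K A x}"

definition dual_space :: "('a::rc_banach \<Rightarrow>\<^sub>L complex) set" where
  "dual_space = {f :: 'a \<Rightarrow>\<^sub>L complex. (\<forall>x. f x \<in> scalars TYPE('a)) \<and>
    (\<forall>c\<in>scalars TYPE('a). \<forall>x. f (c *\<^sub>K x) = c * f x)}"

definition ops_to_dual :: "('a::rc_banach \<Rightarrow>\<^sub>L 'a \<Rightarrow>\<^sub>L complex) set" where
  "ops_to_dual = {P :: 'a \<Rightarrow>\<^sub>L 'a \<Rightarrow>\<^sub>L complex. (\<forall>x. P x \<in> dual_space) \<and>
    (\<forall>c\<in>scalars TYPE('a). \<forall>x y. P (c *\<^sub>K x) y = c * P x y)}"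

definition dual_op :: "('a::rc_banach \<Rightarrow>\<^sub>L 'a) \<Rightarrow> ('a \<Rightarrow>\<^sub>L complex) \<Rightarrow>\<^sub>L ('a \<Rightarrow>\<^sub>L complex)" where
  "dual_op A = Blinfun (\<lambda>f. f o\<^sub>L A)"

lemma dual_op_apply: "dual_op A f = f o\<^sub>L A"
  unfolding dual_op_def
  by (simp add: bounded_linear_Blinfun_apply
      bounded_bilinear.bounded_linear_left[OF bounded_bilinear_blinfun_compose])

text \<open>
  The functional \<open>\<rho> \<mapsto> \<langle>\<langle>P, \<rho>\<rangle>\<rangle>\<close> on the projective tensor product; the lemmas below show that this
  identifies \<^const>\<open>ops_to_dual\<close> isometrically with the dual of \<^typ>\<open>'a::rc_banach ptensor\<close>.
\<close>

definition tensor_functional ::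
  "('a::rc_banach \<Rightarrow>\<^sub>L 'a \<Rightarrow>\<^sub>L complex) \<Rightarrow> 'a ptensor \<Rightarrow>\<^sub>L complex" where
  "tensor_functional P =
    (THE \<phi>. \<phi> \<in> dual_space \<and> (\<forall>x y. \<phi> (of_tensor (x \<otimes> y)) = P x y))"

lemma ops_to_dual_balanced:
  assumes "P \<in> ops_to_dual" shows "balanced (\<lambda>x y. P x y)"
  using assms unfolding balanced_def ops_to_dual_def dual_space_def
  by (simp add: blinfun.add_left blinfun.add_right)

lemma tensor_functional_bounded:
  fixes P :: "'a::rc_banach \<Rightarrow>\<^sub>L 'a \<Rightarrow>\<^sub>L complex"
  assumes P: "P \<in> ops_to_dual"
  shows "norm (tensor_lift (\<lambda>x y. P x y) \<rho>) \<le> norm P * proj_norm \<rho>"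
proof -
  have le: "norm (tensor_lift (\<lambda>x y. P x y) \<rho>) \<le> norm P * (\<Sum>(x, y)\<in>#m. norm x * norm y)"
    if \<rho>: "\<rho> = (\<Sum>(x, y)\<in>#m. x \<otimes> y)" for m
    unfolding \<rho> tensor_lift_sum[OF ops_to_dual_balanced[OF P]]
  proof (induction m)
    case empty
    then show ?case by simp
  next
    case (add p m)
    obtain x y where p: "p = (x, y)" by fastforce
    have "norm (P x y) \<le> norm (P x) * norm y" by (rule norm_blinfun)
    also have "\<dots> \<le> norm P * norm x * norm y" by (intro mult_right_mono norm_blinfun) simp
    finally have "norm (P x y) \<le> norm P * (norm x * norm y)" by (simp add: mult.assoc)
    with add norm_triangle_ineq[of "P x y" "\<Sum>(x, y)\<in>#m. P x y"] show ?case
      by (simp add: p distrib_left)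
  qed
  show ?thesis
  proof (cases "norm P = 0")
    case True
    obtain m where "\<rho> = (\<Sum>(x, y)\<in>#m. x \<otimes> y)" by (rule tensor_cases)
    from le[OF this] show ?thesis unfolding True mult_zero_left .
  next
    case False
    then have pos: "norm P > 0" by simp
    have "norm (tensor_lift (\<lambda>x y. P x y) \<rho>) / norm P \<le> proj_norm \<rho>"
      by (rule proj_norm_ge) (unfold pos_divide_le_eq[OF pos] mult.commute[of _ "norm P"], rule le)
    then show ?thesis by (simp add: pos_divide_le_eq[OF pos] mult.commute)
  qed
qed

lemma tensor_functional_exists:
  fixes P :: "'a::rc_banach \<Rightarrow>\<^sub>L 'a \<Rightarrow>\<^sub>L complex"
  assumes P: "P \<in> ops_to_dual"
  obtains \<phi> :: "'a ptensor \<Rightarrow>\<^sub>L complex"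
  where "\<phi> \<in> dual_space" "\<And>x y. \<phi> (of_tensor (x \<otimes> y)) = P x y"
    "\<And>\<rho>. norm (\<phi> (of_tensor \<rho>)) \<le> norm P * proj_norm \<rho>"
proof -
  let ?f = "tensor_lift (\<lambda>x y. P x y)"
  note bal = ops_to_dual_balanced[OF P]
  have scale: "?f (c *\<^sub>K \<rho>) = c * ?f \<rho>" if "c \<in> scalars TYPE('a)" for c \<rho>
  proof (rule tensor_lift_scaleK[OF bal that, where f = "\<lambda>z. c * z"])
    show "P (c *\<^sub>K x) y = c * P x y" for x y
      using P that unfolding ops_to_dual_def by blast
  qed (simp_all add: distrib_left)
  have "linear ?f"
  proof (rule linearI)
    show "?f (\<rho> + \<sigma>) = ?f \<rho> + ?f \<sigma>" for \<rho> \<sigma> by (rule tensor_lift_add[OF bal])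
    show "?f (r *\<^sub>R \<rho>) = r *\<^sub>R ?f \<rho>" for r \<rho>
      using scale[OF of_real_scalars, of r \<rho>] by (simp add: scaleR_tensor_def scaleR_conv_of_real)
  qed
  from ptensor_extend[OF this tensor_functional_bounded[OF P]]
  obtain \<phi> :: "'a ptensor \<Rightarrow>\<^sub>L complex" where \<phi>: "\<And>\<rho>. \<phi> (of_tensor \<rho>) = ?f \<rho>" by blast
  have val: "?f \<rho> \<in> scalars TYPE('a)" for \<rho>
  proof (induction \<rho> rule: tensor_induct)
    case zero
    show ?case using tensor_lift_sum[OF bal, of "{#}"] of_real_scalars[of 0] by simp
  next
    case (tprod x y)
    show ?case
      unfolding tensor_lift_tprod[OF bal] using P unfolding ops_to_dual_def dual_space_def by blast
  next
    case (add \<rho> \<sigma>)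
    then show ?case unfolding tensor_lift_add[OF bal] by (rule scalars_add)
  qed
  have "\<phi> \<in> dual_space"
    unfolding dual_space_def
  proof (intro CollectI conjI allI ballI)
    fix z :: "'a ptensor"
    obtain u where u: "(\<lambda>n. of_tensor (u n)) \<longlonglongrightarrow> z" by (rule of_tensor_approx)
    have lim: "(\<lambda>n. \<phi> (of_tensor (u n))) \<longlonglongrightarrow> \<phi> z"
      by (intro blinfun.tendsto tendsto_const u)
    show "\<phi> z \<in> scalars TYPE('a ptensor)"
      unfolding scalars_ptensor_def
      by (rule closed_sequentially[OF closed_scalars _ lim]) (simp add: \<phi> val)
    fix c assume "c \<in> scalars TYPE('a ptensor)"
    then have c: "c \<in> scalars TYPE('a)" unfolding scalars_ptensor_def .
    have "(\<lambda>n. norm (c *\<^sub>K (of_tensor (u n) - z))) \<longlonglongrightarrow> 0"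
    proof -
      have "(\<lambda>n. cmod c * norm (of_tensor (u n) - z)) \<longlonglongrightarrow> 0"
        using u by (intro tendsto_mult_right_zero) (simp add: LIM_zero tendsto_norm_zero)
      then show ?thesis unfolding norm_scaleK[OF \<open>c \<in> scalars TYPE('a ptensor)\<close>] .
    qed
    moreover have "c *\<^sub>K (of_tensor (u n) - z) = of_tensor (c *\<^sub>K u n) - c *\<^sub>K z" for n
      using scaleK_add_right[OF \<open>c \<in> scalars TYPE('a ptensor)\<close>, of "of_tensor (u n) - z" z]
      by (simp add: of_tensor_scaleK[OF c])
    ultimately have "(\<lambda>n. of_tensor (c *\<^sub>K u n)) \<longlonglongrightarrow> c *\<^sub>K z"
      by (simp add: LIM_zero_iff tendsto_norm_zero_iff)
    then have "(\<lambda>n. \<phi> (of_tensor (c *\<^sub>K u n))) \<longlonglongrightarrow> \<phi> (c *\<^sub>K z)"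
      by (intro blinfun.tendsto tendsto_const)
    moreover have "(\<lambda>n. \<phi> (of_tensor (c *\<^sub>K u n))) \<longlonglongrightarrow> c * \<phi> z"
      using tendsto_mult[OF tendsto_const lim, of c] by (simp add: \<phi> scale[OF c])
    ultimately show "\<phi> (c *\<^sub>K z) = c * \<phi> z" by (rule LIMSEQ_unique)
  qed
  then show thesis
    using that \<phi> tensor_lift_tprod[OF bal] tensor_functional_bounded[OF P] by metis
qed

lemma tensor_functional:
  fixes P :: "'a::rc_banach \<Rightarrow>\<^sub>L 'a \<Rightarrow>\<^sub>L complex"
  assumes P: "P \<in> ops_to_dual"
  shows "tensor_functional P \<in> dual_space"
    and "tensor_functional P (of_tensor (x \<otimes> y)) = P x y"
proof -
  obtain \<phi> :: "'a ptensor \<Rightarrow>\<^sub>L complex" where \<phi>: "\<phi> \<in> dual_space" "\<And>x y. \<phi> (of_tensor (x \<otimes> y)) = P x y"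
    using tensor_functional_exists[OF P] by metis
  have "tensor_functional P = \<phi>"
    unfolding tensor_functional_def by (rule the_equality) (auto intro: ptensor_eqI simp: \<phi>)
  with \<phi> show "tensor_functional P \<in> dual_space"
    "tensor_functional P (of_tensor (x \<otimes> y)) = P x y" by simp_all
qed

lemma tensor_functional_eqI:
  fixes \<phi> :: "'a::rc_banach ptensor \<Rightarrow>\<^sub>L complex"
  assumes "P \<in> ops_to_dual" "\<And>x y. \<phi> (of_tensor (x \<otimes> y)) = P x y"
  shows "tensor_functional P = \<phi>"
  by (rule ptensor_eqI) (simp add: assms tensor_functional(2))

lemma tensor_functional_linear:
  fixes P Q R :: "'a::rc_banach \<Rightarrow>\<^sub>L 'a \<Rightarrow>\<^sub>L complex"
  assumes "P \<in> ops_to_dual" "Q \<in> ops_to_dual" "R \<in> ops_to_dual"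
    and "\<And>x y. R x y = c * P x y + Q x y"
  shows "tensor_functional R z = c * tensor_functional P z + tensor_functional Q z"
proof -
  have "tensor_functional R = (blinfun_mult_right c o\<^sub>L tensor_functional P) + tensor_functional Q"
    by (rule tensor_functional_eqI)
      (simp_all add: assms tensor_functional(2) blinfun.add_left blinfun_mult_right.rep_eq)
  then show ?thesis by (simp add: blinfun.add_left blinfun_mult_right.rep_eq)
qed

lemma norm_tensor_functional:
  fixes P :: "'a::rc_banach \<Rightarrow>\<^sub>L 'a \<Rightarrow>\<^sub>L complex"
  assumes P: "P \<in> ops_to_dual"
  shows "norm (tensor_functional P) = norm P"
proof (rule antisym)
  obtain \<phi> :: "'a ptensor \<Rightarrow>\<^sub>L complex" where \<phi>: "\<And>x y. \<phi> (of_tensor (x \<otimes> y)) = P x y"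
    "\<And>\<rho>. norm (\<phi> (of_tensor \<rho>)) \<le> norm P * proj_norm \<rho>"
    using tensor_functional_exists[OF P] by metis
  show "norm (tensor_functional P) \<le> norm P"
  proof (rule norm_blinfun_bound)
    fix z :: "'a ptensor"
    obtain u where u: "(\<lambda>n. of_tensor (u n)) \<longlonglongrightarrow> z" by (rule of_tensor_approx)
    show "norm (tensor_functional P z) \<le> norm P * norm z"
      unfolding tensor_functional_eqI[OF P \<phi>(1)]
    proof (rule LIMSEQ_le)
      show "(\<lambda>n. norm (\<phi> (of_tensor (u n)))) \<longlonglongrightarrow> norm (\<phi> z)"
        by (intro tendsto_norm blinfun.tendsto tendsto_const u)
      show "(\<lambda>n. norm P * norm (of_tensor (u n))) \<longlonglongrightarrow> norm P * norm z"
        by (intro tendsto_mult tendsto_norm tendsto_const u)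
    qed (use \<phi>(2) in \<open>simp add: norm_of_tensor\<close>)
  qed simp
  show "norm P \<le> norm (tensor_functional P)"
  proof (rule norm_blinfun_bound[OF norm_ge_zero])
    fix x
    show "norm (P x) \<le> norm (tensor_functional P) * norm x"
    proof (rule norm_blinfun_bound)
      fix y
      have "norm (P x y) \<le> norm (tensor_functional P) * proj_norm (x \<otimes> y)"
        using norm_blinfun[of "tensor_functional P" "of_tensor (x \<otimes> y)"]
        by (simp add: tensor_functional(2)[OF P] norm_of_tensor)
      also have "\<dots> \<le> norm (tensor_functional P) * (norm x * norm y)"
        by (intro mult_left_mono proj_norm_tprod_le norm_ge_zero)
      finally show "norm (P x y) \<le> norm (tensor_functional P) * norm x * norm y"
        by (simp add: mult.assoc)
    qed simp
  qed
qed

lemma bij_betw_tensor_functional: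
  "bij_betw tensor_functional ops_to_dual (dual_space :: ('a::rc_banach ptensor \<Rightarrow>\<^sub>L complex) set)"
proof (rule bij_betwI')
  fix P Q :: "'a \<Rightarrow>\<^sub>L 'a \<Rightarrow>\<^sub>L complex" assume P: "P \<in> ops_to_dual" and Q: "Q \<in> ops_to_dual"
  show "tensor_functional P = tensor_functional Q \<longleftrightarrow> P = Q"
    using tensor_functional(2)[OF P] tensor_functional(2)[OF Q] by (metis blinfun_eqI)
  show "tensor_functional P \<in> dual_space" by (rule tensor_functional(1)[OF P])
next
  fix \<phi> :: "'a ptensor \<Rightarrow>\<^sub>L complex" assume \<phi>: "\<phi> \<in> dual_space"
  let ?B = "\<lambda>x y. \<phi> (of_tensor (x \<otimes> y))"
  have sR: "(r *\<^sub>R x) \<otimes> y = r *\<^sub>R (x \<otimes> y)" "x \<otimes> (r *\<^sub>R y) = r *\<^sub>R (x \<otimes> y)" for r and x y :: 'a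
    using tprod_scaleK_left[OF of_real_scalars, of r x y]
      tprod_scaleK_right[OF of_real_scalars, of x r y]
    by (simp_all add: scaleK_of_real scaleR_tensor_def)
  have "bounded_bilinear ?B"
  proof
    show "\<exists>K. \<forall>x y. norm (?B x y) \<le> norm x * norm y * K"
    proof (intro exI allI)
      fix x y
      have "norm (?B x y) \<le> norm \<phi> * proj_norm (x \<otimes> y)"
        using norm_blinfun[of \<phi> "of_tensor (x \<otimes> y)"] by (simp add: norm_of_tensor)
      also have "\<dots> \<le> norm \<phi> * (norm x * norm y)"
        by (intro mult_left_mono proj_norm_tprod_le norm_ge_zero)
      finally show "norm (?B x y) \<le> norm x * norm y * norm \<phi>" by (simp add: mult.commute)
    qed
  qed (simp_all add: tprod_add_left tprod_add_right of_tensor_add sR of_tensor_scaleR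
      blinfun.add_right blinfun.scaleR_right)
  then interpret B: bounded_bilinear ?B .
  have BB: "blinfun_apply (Blinfun (?B x)) = ?B x" for x
    by (rule bounded_linear_Blinfun_apply) (rule B.bounded_linear_right)
  define P where "P = Blinfun (\<lambda>x. Blinfun (?B x))"
  have Px: "blinfun_apply (P x) = ?B x" for x
  proof -
    have "bounded_linear (\<lambda>x. Blinfun (?B x))"
    proof (rule bounded_linear_intro)
      fix x x' :: 'a and r :: real
      show "Blinfun (?B (x + x')) = Blinfun (?B x) + Blinfun (?B x')"
        by (rule blinfun_eqI) (unfold blinfun.add_left BB, rule B.add_left)
      show "Blinfun (?B (r *\<^sub>R x)) = r *\<^sub>R Blinfun (?B x)"
        by (rule blinfun_eqI) (unfold blinfun.scaleR_left BB, rule B.scaleR_left)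
      show "norm (Blinfun (?B x)) \<le> norm x * norm \<phi>"
      proof (rule norm_blinfun_bound)
        fix y
        have "norm (?B x y) \<le> norm \<phi> * proj_norm (x \<otimes> y)"
          using norm_blinfun[of \<phi> "of_tensor (x \<otimes> y)"] by (simp add: norm_of_tensor)
        also have "\<dots> \<le> norm \<phi> * (norm x * norm y)"
          by (intro mult_left_mono proj_norm_tprod_le norm_ge_zero)
        finally show "norm (Blinfun (?B x) y) \<le> norm x * norm \<phi> * norm y"
          by (simp add: BB ac_simps)
      qed simp
    qed
    then have "P x = Blinfun (?B x)" by (simp add: P_def bounded_linear_Blinfun_apply)
    then show ?thesis by (simp only: BB)
  qed
  have "P \<in> ops_to_dual"
    using \<phi> unfolding ops_to_dual_def dual_space_def
    by (simp add: Px scalars_ptensor_def tprod_scaleK_left tprod_scaleK_right of_tensor_scaleK)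
  moreover from this have "tensor_functional P = \<phi>"
    by (rule tensor_functional_eqI) (simp add: Px)
  ultimately show "\<exists>P\<in>ops_to_dual. \<phi> = tensor_functional P" by blast
qed


section \<open>Semigroups\<close>

definition C0_semigroup :: "(real \<Rightarrow> 'a::rc_banach \<Rightarrow>\<^sub>L 'a) \<Rightarrow> bool" where
  "C0_semigroup T \<longleftrightarrow>
    (\<forall>t\<ge>0. T t \<in> bounded_ops) \<and>
    T 0 = id_blinfun \<and>
    (\<forall>s\<ge>0. \<forall>t\<ge>0. T (s + t) = T s o\<^sub>L T t) \<and>
    (\<forall>x. ((\<lambda>t. T t x) \<longlongrightarrow> x) (at_right 0))"

text \<open>The operator \<open>A \<otimes> B\<close> on the algebraic tensor product.\<close>

definition tensor_map ::
  "('a::rc_banach \<Rightarrow>\<^sub>L 'a) \<Rightarrow> ('a \<Rightarrow>\<^sub>L 'a) \<Rightarrow> 'a tensor \<Rightarrow> 'a tensor" where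
  "tensor_map A B = tensor_lift (\<lambda>x y. A x \<otimes> B y)"

lemma tensor_map_balanced:
  "A \<in> bounded_ops \<Longrightarrow> B \<in> bounded_ops \<Longrightarrow> balanced (\<lambda>x y. A x \<otimes> B y)"
  unfolding balanced_def bounded_ops_def
  by (simp add: blinfun.add_right tprod_add_left tprod_add_right tprod_scaleK_left
      tprod_scaleK_right)

lemma tensor_map_tprod:
  "A \<in> bounded_ops \<Longrightarrow> B \<in> bounded_ops \<Longrightarrow> tensor_map A B (x \<otimes> y) = A x \<otimes> B y"
  unfolding tensor_map_def by (rule tensor_lift_tprod[OF tensor_map_balanced])

lemma tensor_map_add:
  "A \<in> bounded_ops \<Longrightarrow> B \<in> bounded_ops \<Longrightarrow>
    tensor_map A B (\<rho> + \<sigma>) = tensor_map A B \<rho> + tensor_map A B \<sigma>"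
  unfolding tensor_map_def by (rule tensor_lift_add[OF tensor_map_balanced])

definition implemented ::
  "(real \<Rightarrow> 'a::rc_banach \<Rightarrow>\<^sub>L 'a) \<Rightarrow> (real \<Rightarrow> 'a \<Rightarrow>\<^sub>L 'a) \<Rightarrow>
    real \<Rightarrow> ('a \<Rightarrow>\<^sub>L 'a \<Rightarrow>\<^sub>L complex) \<Rightarrow> ('a \<Rightarrow>\<^sub>L 'a \<Rightarrow>\<^sub>L complex)" where
  "implemented T V t P = dual_op (V t) o\<^sub>L P o\<^sub>L T t"

text \<open>
  \<open>U\<close>, an operator on the space \<^const>\<open>ops_to_dual\<close>, is the adjoint of the operator \<open>S\<close> on the
  projective tensor product.
\<close>

definition is_adjoint ::
  "(('a::rc_banach \<Rightarrow>\<^sub>L 'a \<Rightarrow>\<^sub>L complex) \<Rightarrow> ('a \<Rightarrow>\<^sub>L 'a \<Rightarrow>\<^sub>L complex)) \<Rightarrow>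
    ('a ptensor \<Rightarrow>\<^sub>L 'a ptensor) \<Rightarrow> bool" where
  "is_adjoint U S \<longleftrightarrow>
    (\<forall>P\<in>ops_to_dual. U P \<in> ops_to_dual \<and>
      tensor_functional (U P) = dual_op S (tensor_functional P))"

definition C0star_semigroup ::
  "(real \<Rightarrow> ('a::rc_banach \<Rightarrow>\<^sub>L 'a \<Rightarrow>\<^sub>L complex) \<Rightarrow> ('a \<Rightarrow>\<^sub>L 'a \<Rightarrow>\<^sub>L complex)) \<Rightarrow> bool" where
  "C0star_semigroup U \<longleftrightarrow>
    (\<forall>t\<ge>0. \<forall>P\<in>ops_to_dual. U t P \<in> ops_to_dual) \<and>
    (\<forall>P\<in>ops_to_dual. U 0 P = P) \<and>
    (\<forall>s\<ge>0. \<forall>t\<ge>0. \<forall>P\<in>ops_to_dual. U (s + t) P = U s (U t P)) \<and>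
    (\<forall>P\<in>ops_to_dual. \<forall>\<rho>. continuous_on {0..} (\<lambda>t. tensor_functional (U t P) \<rho>)) \<and>
    (\<exists>S. C0_semigroup S \<and> (\<forall>t\<ge>0. is_adjoint (U t) (S t)))"

end

(*
  The projective norm is multiplicative, norm (A \<otimes> B) \<le> norm A * norm B, so each T(t) \<otimes> V(t)
  extends to the completion. By the uniform boundedness principle, T and V are bounded near 0,
  hence so is the extension, and its strong continuity only has to be checked on elementary
  tensors. Testing on elementary tensors also identifies the implemented semigroup as the
  adjoint; weak* continuity is then strong continuity on the pre-dual.
*)

theory Submission
  imports Defs
begin

section \<open>The uniform boundedness principle\<close>

lemma uniform_boundedness:
  fixes A :: "'i \<Rightarrow> 'a::banach \<Rightarrow>\<^sub>L 'b::real_normed_vector"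
  assumes bdd: "\<And>x. \<exists>K. \<forall>i\<in>I. norm (A i x) \<le> K"
  shows "\<exists>M. \<forall>i\<in>I. norm (A i) \<le> M"
proof -
  \<comment> \<open>Baire category argument: the \<open>F n\<close> are closed and, by pointwise
    boundedness, cover the complete domain, so one of them contains a closed ball
    \<open>cball x e\<close>.\<close>
  define F where "F n = {x. \<forall>i\<in>I. norm (A i x) \<le> real n}" for n
  have closed_F: "closed (F n)" for n
    unfolding F_def Collect_ball_eq
    by (intro closed_INT ballI closed_Collect_le continuous_intros)
  have "\<Union>(range F) = UNIV"
  proof (intro equalityI subset_UNIV subsetI)
    fix x
    obtain K where K: "\<forall>i\<in>I. norm (A i x) \<le> K" using bdd by blast
    obtain n where "K \<le> real n" using real_arch_simple by blast
    with K have "x \<in> F n" unfolding F_def by force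
    then show "x \<in> \<Union>(range F)" by blast
  qed
  moreover have "euclidean interior_of \<Union>(range F) = {}" if "\<And>n. interior (F n) = {}"
    using that closed_F
    by (intro Baire_category_alt disjI1 completely_metrizable_space_euclidean) auto
  ultimately obtain n where "interior (F n) \<noteq> {}" by fastforce
  then obtain x e where e: "e > 0" and sub: "cball x e \<subseteq> F n"
    by (auto simp: mem_interior_cball)
  have "norm (A i) \<le> 2 * real n / e" if i: "i \<in> I" for i
  proof (rule norm_blinfun_bound)
    fix z
    show "norm (A i z) \<le> 2 * real n / e * norm z"
    proof (cases "z = 0")
      case False
      \<comment> \<open>Rescaling \<open>z\<close> to norm \<open>e\<close> keeps
        \<open>x + y\<close> inside the ball, so \<open>A i y\<close> is the difference of two
        values of norm at most \<open>n\<close>. Scaling back gives the bound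
        \<open>2 * real n / e\<close>.\<close>
      define y where "y = (e / norm z) *\<^sub>R z"
      have "x + y \<in> F n" "x \<in> F n"
        using sub e False by (auto simp: y_def dist_norm)
      then have "norm (A i (x + y)) \<le> real n" "norm (A i x) \<le> real n"
        using i by (auto simp: F_def)
      then have "norm (A i y) \<le> 2 * real n"
        using norm_triangle_ineq4[of "A i (x + y)" "A i x"] by (simp add: blinfun.add_right)
      moreover have "norm (A i y) = e / norm z * norm (A i z)"
        using e by (simp add: y_def blinfun.scaleR_right)
      ultimately show ?thesis using e False by (simp add: field_simps)
    qed simp
  qed (use e in simp)
  then show ?thesis by blast
qed

section \<open>Local boundedness and strong continuity of C0 semigroups\<close>

lemma C0_semigroup_bounded_ops: "C0_semigroup T \<Longrightarrow> 0 \<le> t \<Longrightarrow> T t \<in> bounded_ops"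
  unfolding C0_semigroup_def by blast

lemma C0_semigroup_0: "C0_semigroup T \<Longrightarrow> T 0 x = x"
  unfolding C0_semigroup_def by simp

lemma C0_semigroup_add:
  "C0_semigroup T \<Longrightarrow> 0 \<le> s \<Longrightarrow> 0 \<le> t \<Longrightarrow> T (s + t) x = T s (T t x)"
  unfolding C0_semigroup_def by simp

lemma C0_semigroup_tendsto: "C0_semigroup T \<Longrightarrow> ((\<lambda>t. T t x) \<longlongrightarrow> x) (at_right 0)"
  unfolding C0_semigroup_def by blast

text \<open>Otherwise there are times \<open>t n\<close> decreasing below
  \<open>inverse (Suc n)\<close> with \<open>norm (T (t n)) > n\<close>. Along this sequence each
  orbit converges to \<open>x\<close>, hence is bounded, which contradicts uniform
  boundedness.\<close>

lemma C0_semigroup_bounded_near_0: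
  assumes T: "C0_semigroup T"
  obtains M where "M > 0" "\<forall>\<^sub>F t in at_right 0. norm (T t) \<le> M"
proof -
  have "\<exists>M. \<forall>\<^sub>F t in at_right 0. norm (T t) \<le> M"
  proof (rule ccontr)
    assume "\<not> ?thesis"
    then have "\<exists>t>0. t < inverse (real (Suc n)) \<and> real n < norm (T t)" for n
      unfolding eventually_at_right_field
      by (meson inverse_positive_iff_positive not_le of_nat_0_less_iff zero_less_Suc)
    then obtain t where t: "\<And>n. 0 < t n" "\<And>n. t n < inverse (real (Suc n))"
      "\<And>n. real n < norm (T (t n))" by metis
    have "t \<longlonglongrightarrow> 0"
      by (rule tendsto_sandwich[OF _ _ tendsto_const LIMSEQ_inverse_real_of_nat])
        (intro always_eventually allI less_imp_le t)+
    then have lim: "filterlim t (at_right 0) sequentially"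
      using t(1) by (simp add: filterlim_at less_imp_neq[symmetric])
    have "\<exists>K. \<forall>n\<in>UNIV. norm (T (t n) x) \<le> K" for x
      using convergent_imp_Bseq[OF convergentI[OF
            filterlim_compose[OF C0_semigroup_tendsto[OF T] lim]]]
      by (auto simp: Bseq_def)
    from uniform_boundedness[of UNIV "\<lambda>n. T (t n)", OF this]
    obtain M where "\<And>n. norm (T (t n)) \<le> M" by blast
    moreover obtain n where "M \<le> real n" using real_arch_simple by blast
    ultimately show False using t(3)[of n] by (meson not_le order_trans)
  qed
  then obtain M where "\<forall>\<^sub>F t in at_right 0. norm (T t) \<le> M" by blast
  then have "\<forall>\<^sub>F t in at_right 0. norm (T t) \<le> max M 1"
    by (rule eventually_mono) simp
  then show thesis by (intro that[of "max M 1"]) simp_all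
qed

text \<open>The definition grants only right continuity at 0, while the weak-star continuity of an
  adjoint semigroup is required on all of \<open>{0..}\<close>. Left and right continuity at later
  times come from \<open>T v x - T u x = T u (T (v - u) x - x)\<close> for \<open>u < v\<close> and
  the bound on \<open>T u\<close> near 0; the semigroup law then transports this to every
  time.\<close>

lemma C0_semigroup_continuous_on:
  assumes T: "C0_semigroup T"
  shows "continuous_on {0..} (\<lambda>t. T t x)"
proof -
  obtain M where M: "M > 0" and ev: "\<forall>\<^sub>F t in at_right 0. norm (T t) \<le> M"
    using C0_semigroup_bounded_near_0[OF T] by blast
  from ev obtain d where d: "d > 0" and dM: "\<And>t. 0 < t \<Longrightarrow> t < d \<Longrightarrow> norm (T t) \<le> M"
    unfolding eventually_at_right_field by blast
  have near_0: "continuous_on {0..<d} (\<lambda>t. T t x)" for x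
    unfolding continuous_on_iff
  proof (intro ballI allI impI)
    fix t e :: real assume t: "t \<in> {0..<d}" and e: "e > 0"
    \<comment> \<open>The bound \<open>dM\<close> does not cover time 0, where \<open>T 0\<close> is
      the identity; \<open>max M 1\<close> dominates both cases.\<close>
    then have e': "e / max M 1 > 0" by (simp add: less_max_iff_disj)
    from tendstoD[OF C0_semigroup_tendsto[OF T] this, of x]
    obtain b where b: "b > 0" "\<And>h. 0 < h \<Longrightarrow> h < b \<Longrightarrow> dist (T h x) x < e / max M 1"
      unfolding eventually_at_right_field by blast
    have le: "dist (T v x) (T u x) < e" if "0 \<le> u" "u < v" "v - u < b" "u < d" for u v
    proof -
      have h: "norm (T (v - u) x - x) < e / max M 1"
        using b(2)[of "v - u"] that by (simp add: dist_norm)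
      have "T v x - T u x = T u (T (v - u) x - x)"
        using C0_semigroup_add[OF T, of u "v - u" x] that by (simp add: blinfun.diff_right)
      moreover have "norm (T u y) \<le> max M 1 * norm y" for y
      proof (cases "u = 0")
        case True
        then show ?thesis
          using mult_right_mono[of 1 "max M 1" "norm y"] by (simp add: C0_semigroup_0[OF T])
      next
        case False
        have "norm (T u y) \<le> norm (T u) * norm y" by (rule norm_blinfun)
        also have "\<dots> \<le> max M 1 * norm y"
          using dM[of u] that False by (intro mult_right_mono) auto
        finally show ?thesis .
      qed
      ultimately have "norm (T v x - T u x) \<le> max M 1 * norm (T (v - u) x - x)" by simp
      also have "\<dots> < e"
        using h by (simp add: pos_less_divide_eq less_max_iff_disj mult.commute)
      finally show ?thesis by (simp add: dist_norm)
    qed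
    show "\<exists>b>0. \<forall>s\<in>{0..<d}. dist s t < b \<longrightarrow> dist (T s x) (T t x) < e"
    proof (intro exI[of _ b] conjI ballI impI b(1))
      fix s assume s: "s \<in> {0..<d}" "dist s t < b"
      show "dist (T s x) (T t x) < e"
        using le[of s t] le[of t s] s t e
        by (cases s t rule: linorder_cases) (auto simp: dist_real_def dist_commute)
    qed
  qed
  show ?thesis
    unfolding continuous_on_eq_continuous_within
  proof
    fix t :: real assume "t \<in> {0..}"
    \<comment> \<open>The window \<open>{a..<a + d}\<close> has length \<open>d\<close> and contains
      \<open>t\<close>. On it, \<open>T s x = T (s - a) (T a x)\<close>, so continuity of the orbit
      of \<open>T a x\<close> on \<open>{0..<d}\<close> applies.\<close>
    define a where "a = max 0 (t - d / 2)"
    have a: "0 \<le> a" "a \<le> t" "t < a + d" using \<open>t \<in> {0..}\<close> d by (auto simp: a_def)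
    have "continuous_on {a..<a + d} (\<lambda>s. T (s - a) (T a x))"
      by (rule continuous_on_compose2[OF near_0]) (auto intro!: continuous_intros)
    then have "continuous_on {a..<a + d} (\<lambda>s. T s x)"
      using C0_semigroup_add[OF T, of _ a x] a(1)
      by (subst (asm) continuous_on_cong[OF refl, where g = "\<lambda>s. T s x"])
        (metis add.commute atLeastLessThan_iff diff_add_cancel diff_ge_0_iff_ge)+
    then have "continuous (at t within {a..<a + d}) (\<lambda>s. T s x)"
      using a by (simp add: continuous_on_eq_continuous_within)
    \<comment> \<open>Within distance \<open>d / 2\<close> of \<open>t\<close> the window coincides
      with \<open>{0..}\<close>, including the one-sided situation at \<open>t = 0\<close>.\<close>
    moreover have "at t within {a..<a + d} = at t within {0..}"
      by (rule at_within_nhd[of t "{t - d / 2<..<t + d / 2}"])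
        (use d \<open>t \<in> {0..}\<close> in \<open>auto simp: a_def\<close>)
    ultimately show "continuous (at t within {0..}) (\<lambda>s. T s x)" by simp
  qed
qed

text \<open>A three-epsilon argument: approximate \<open>x\<close> by \<open>y\<close> in
  \<open>D\<close> and split \<open>F t x - x\<close> into \<open>F t (x - y)\<close>,
  \<open>F t y - y\<close> and \<open>y - x\<close>. It reduces strong continuity on the completion
  to the algebraic tensor product.\<close>

lemma tendsto_blinfun_closure:
  fixes F :: "'t \<Rightarrow> 'a::real_normed_vector \<Rightarrow>\<^sub>L 'a"
  assumes bound: "\<forall>\<^sub>F t in G. norm (F t) \<le> M"
    and lim: "\<And>y. y \<in> D \<Longrightarrow> ((\<lambda>t. F t y) \<longlongrightarrow> y) G" and x: "x \<in> closure D"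
  shows "((\<lambda>t. F t x) \<longlongrightarrow> x) G"
proof (rule tendstoI)
  fix e :: real assume e: "e > 0"
  \<comment> \<open>With \<open>M' \<ge> 1\<close>, the single estimate
    \<open>M' * norm (x - y) < e / 3\<close> controls both \<open>F t (x - y)\<close> and
    \<open>y - x\<close>.\<close>
  define M' where "M' = max M 0 + 1"
  have M': "M \<le> M'" "M' > 0" "M' \<ge> 1" by (auto simp: M'_def)
  obtain y where y: "y \<in> D" "dist y x < e / (3 * M')"
    using x e M' unfolding closure_approachable by (metis divide_pos_pos mult_pos_pos zero_less_numeral)
  have xy: "M' * norm (x - y) < e / 3"
    using y(2) M' by (simp add: dist_norm norm_minus_commute field_simps)
  then have xy': "norm (x - y) < e / 3"
    using mult_right_mono[OF M'(3), of "norm (x - y)"] by simp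
  have "\<forall>\<^sub>F t in G. dist (F t y) y < e / 3"
    using tendstoD[OF lim[OF y(1)], of "e / 3"] e by simp
  with bound show "\<forall>\<^sub>F t in G. dist (F t x) x < e"
  proof eventually_elim
    case (elim t)
    have "norm (F t (x - y)) \<le> norm (F t) * norm (x - y)" by (rule norm_blinfun)
    also have "\<dots> \<le> M' * norm (x - y)" using elim(1) M' by (intro mult_right_mono) auto
    finally have "norm (F t (x - y)) < e / 3" using xy by simp
    moreover have "F t x - x = F t (x - y) + (F t y - y) + (y - x)"
      by (simp add: blinfun.diff_right)
    ultimately show ?case
      using norm_triangle_ineq[of "F t (x - y) + (F t y - y)" "y - x"]
        norm_triangle_ineq[of "F t (x - y)" "F t y - y"] elim(2) xy'
      by (simp add: dist_norm norm_minus_commute)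
  qed
qed

section \<open>Tensor products of operators and their extension to the completion\<close>

lemma tensor_map_scaleK:
  assumes "A \<in> bounded_ops" "B \<in> bounded_ops" "c \<in> scalars TYPE('a::rc_banach)"
  shows "tensor_map A B (c *\<^sub>K \<rho>) = c *\<^sub>K tensor_map A B (\<rho> :: 'a tensor)"
  unfolding tensor_map_def
proof (rule tensor_lift_scaleK[OF tensor_map_balanced[OF assms(1,2)] assms(3)])
  show "c *\<^sub>K (0 :: 'a tensor) = 0" using tensor_scaleK_add_right[of c 0 0] by simp
  show "A (c *\<^sub>K x) \<otimes> B y = c *\<^sub>K (A x \<otimes> B y)" for x y
    using assms(1,3) by (simp add: bounded_ops_def tprod_scaleK_left)
qed (rule tensor_scaleK_add_right)

lemma linear_tensor_map: "A \<in> bounded_ops \<Longrightarrow> B \<in> bounded_ops \<Longrightarrow> linear (tensor_map A B)"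
  by (rule linearI) (simp_all add: tensor_map_add tensor_map_scaleK scaleR_tensor_def)

text \<open>Applying \<open>A\<close> and \<open>B\<close> to the factors of any representation of
  \<open>\<rho>\<close> gives a representation of the image whose cost grows by at most
  \<open>norm A * norm B\<close>; then take the infimum over representations. This divides by
  \<open>norm A * norm B\<close>, so a vanishing product is treated separately.\<close>

lemma proj_norm_tensor_map:
  assumes A: "A \<in> bounded_ops" and B: "B \<in> bounded_ops"
  shows "proj_norm (tensor_map A B \<rho>) \<le> norm A * norm B * proj_norm \<rho>"
proof -
  have le: "proj_norm (tensor_map A B \<rho>) \<le> norm A * norm B * (\<Sum>(x, y)\<in>#m. norm x * norm y)"
    if \<rho>: "\<rho> = (\<Sum>(x, y)\<in>#m. x \<otimes> y)" for m
    unfolding \<rho>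
  proof (induction m)
    case empty
    then show ?case by (simp add: linear_0[OF linear_tensor_map[OF A B]])
  next
    case (add p m)
    obtain x y where p: "p = (x, y)" by fastforce
    have "proj_norm (A x \<otimes> B y) \<le> norm (A x) * norm (B y)" by (rule proj_norm_tprod_le)
    also have "\<dots> \<le> (norm A * norm x) * (norm B * norm y)"
      by (intro mult_mono norm_blinfun) simp_all
    finally have "proj_norm (A x \<otimes> B y) \<le> norm A * norm B * (norm x * norm y)"
      by (simp add: ac_simps)
    with add proj_norm_triangle[of "A x \<otimes> B y" "tensor_map A B (\<Sum>(x, y)\<in>#m. x \<otimes> y)"]
    show ?case
      by (simp add: p tensor_map_add[OF A B] tensor_map_tprod[OF A B] distrib_left)
  qed
  show ?thesis
  proof (cases "norm A * norm B = 0")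
    case True
    obtain m where "\<rho> = (\<Sum>(x, y)\<in>#m. x \<otimes> y)" by (rule tensor_cases)
    from le[OF this] show ?thesis unfolding True mult_zero_left .
  next
    case False
    then have pos: "norm A * norm B > 0"
      using mult_nonneg_nonneg[OF norm_ge_zero norm_ge_zero, of A B] by linarith
    have "proj_norm (tensor_map A B \<rho>) / (norm A * norm B) \<le> proj_norm \<rho>"
      by (rule proj_norm_ge)
        (unfold pos_divide_le_eq[OF pos] mult.commute[of _ "norm A * norm B"], rule le)
    then show ?thesis unfolding pos_divide_le_eq[OF pos] by (simp add: mult.commute)
  qed
qed

text \<open>For \<open>A\<close> and \<open>B\<close> in \<open>bounded_ops\<close> the choice is
  harmless: the extension exists by \<open>ptensor_extend\<close> and is unique by
  \<open>ptensor_eqI\<close>.\<close>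

definition ptensor_map ::
  "('a::rc_banach \<Rightarrow>\<^sub>L 'a) \<Rightarrow> ('a \<Rightarrow>\<^sub>L 'a) \<Rightarrow> 'a ptensor \<Rightarrow>\<^sub>L 'a ptensor" where
  "ptensor_map A B =
    (SOME S :: 'a ptensor \<Rightarrow>\<^sub>L 'a ptensor. \<forall>\<rho>. S (of_tensor \<rho>) = of_tensor (tensor_map A B \<rho>))"

context
  fixes A B :: "'a::rc_banach \<Rightarrow>\<^sub>L 'a"
  assumes A: "A \<in> bounded_ops" and B: "B \<in> bounded_ops"
begin

lemma ptensor_map_of_tensor: "ptensor_map A B (of_tensor \<rho>) = of_tensor (tensor_map A B \<rho>)"
proof -
  have "linear (\<lambda>\<rho>. of_tensor (tensor_map A B \<rho>))"
    using linear_compose[OF linear_tensor_map[OF A B] linear_of_tensor] by (simp add: comp_def)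
  from ptensor_extend[OF this, of "norm A * norm B"]
  have "\<exists>S :: 'a ptensor \<Rightarrow>\<^sub>L 'a ptensor. \<forall>\<rho>. S (of_tensor \<rho>) = of_tensor (tensor_map A B \<rho>)"
    by (metis norm_of_tensor proj_norm_tensor_map[OF A B])
  from someI_ex[OF this] show ?thesis unfolding ptensor_map_def by blast
qed

lemma ptensor_map_tprod: "ptensor_map A B (of_tensor (x \<otimes> y)) = of_tensor (A x \<otimes> B y)"
  by (simp add: ptensor_map_of_tensor tensor_map_tprod[OF A B])

lemma norm_ptensor_map: "norm (ptensor_map A B) \<le> norm A * norm B"
proof (rule norm_blinfun_bound)
  fix z :: "'a ptensor"
  obtain u where u: "(\<lambda>n. of_tensor (u n)) \<longlonglongrightarrow> z" by (rule of_tensor_approx)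
  show "norm (ptensor_map A B z) \<le> norm A * norm B * norm z"
  proof (rule LIMSEQ_le)
    show "(\<lambda>n. norm (ptensor_map A B (of_tensor (u n)))) \<longlonglongrightarrow> norm (ptensor_map A B z)"
      by (intro tendsto_norm blinfun.tendsto tendsto_const u)
    show "(\<lambda>n. norm A * norm B * norm (of_tensor (u n))) \<longlonglongrightarrow> norm A * norm B * norm z"
      by (intro tendsto_mult tendsto_norm tendsto_const u)
  qed (simp add: ptensor_map_of_tensor norm_of_tensor proj_norm_tensor_map[OF A B])
qed simp

text \<open>The operator type gives real linearity only. Multiplication by a scalar \<open>c\<close>
  is itself packaged as a bounded operator \<open>C\<close>, so that commutation with
  \<open>C\<close> becomes an identity of bounded operators, which \<open>ptensor_eqI\<close> tests
  on elementary tensors.\<close>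

lemma ptensor_map_bounded_ops: "ptensor_map A B \<in> bounded_ops"
  unfolding bounded_ops_def
proof (intro CollectI ballI allI)
  fix c and z :: "'a ptensor" assume c: "c \<in> scalars TYPE('a ptensor)"
  then have c': "c \<in> scalars TYPE('a)" by (simp add: scalars_ptensor_def)
  have "bounded_linear (\<lambda>z :: 'a ptensor. c *\<^sub>K z)"
  proof (rule bounded_linear_intro)
    fix z w :: "'a ptensor" and r :: real
    show "c *\<^sub>K (z + w) = c *\<^sub>K z + c *\<^sub>K w" by (rule scaleK_add_right[OF c])
    show "c *\<^sub>K r *\<^sub>R z = r *\<^sub>R c *\<^sub>K z"
      using scaleK_scaleK[OF c of_real_scalars, of r z] scaleK_scaleK[OF of_real_scalars c, of r z]
      by (simp add: scaleK_of_real mult.commute)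
    show "norm (c *\<^sub>K z) \<le> norm z * cmod c" by (simp add: norm_scaleK[OF c] mult.commute)
  qed
  then obtain C :: "'a ptensor \<Rightarrow>\<^sub>L 'a ptensor" where C: "\<And>z. C z = c *\<^sub>K z"
    using bounded_linear_Blinfun_apply by metis
  have "ptensor_map A B o\<^sub>L C = C o\<^sub>L ptensor_map A B"
    by (rule ptensor_eqI)
      (simp add: C of_tensor_scaleK[OF c', symmetric] ptensor_map_of_tensor
        tensor_map_scaleK[OF A B c'])
  from arg_cong[OF this, of "\<lambda>S. S z"]
  show "ptensor_map A B (c *\<^sub>K z) = c *\<^sub>K ptensor_map A B z" by (simp add: C)
qed

end

section \<open>The tensor product semigroup on the completion\<close>

lemma of_tensor_tprod_scaleR:
  "of_tensor ((r *\<^sub>R x) \<otimes> y) = r *\<^sub>R of_tensor (x \<otimes> y)"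
  "of_tensor (x \<otimes> (r *\<^sub>R y)) = r *\<^sub>R of_tensor (x \<otimes> y)"
  using tprod_scaleK_left[OF of_real_scalars, of r x y]
    tprod_scaleK_right[OF of_real_scalars, of x r y]
  by (simp_all add: scaleK_of_real of_tensor_scaleK)

text \<open>Supplies the joint continuity by which \<open>T t x \<otimes> V t y\<close> tends to
  \<open>x \<otimes> y\<close>.\<close>

lemma bounded_bilinear_tprod: "bounded_bilinear (\<lambda>x y. of_tensor (x \<otimes> y))"
proof
  show "\<exists>K. \<forall>x y :: 'a. norm (of_tensor (x \<otimes> y)) \<le> norm x * norm y * K"
    by (rule exI[of _ 1]) (simp add: norm_of_tensor proj_norm_tprod_le)
qed (simp_all add: tprod_add_left tprod_add_right of_tensor_add of_tensor_tprod_scaleR)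

lemma C0_semigroup_ptensor_map:
  assumes T: "C0_semigroup T" and V: "C0_semigroup V"
  shows "C0_semigroup (\<lambda>t. ptensor_map (T t) (V t))"
  unfolding C0_semigroup_def
proof (intro conjI allI impI)
  note T_op = C0_semigroup_bounded_ops[OF T] and V_op = C0_semigroup_bounded_ops[OF V]
  note tprod = ptensor_map_tprod[OF T_op V_op]
  show "ptensor_map (T t) (V t) \<in> bounded_ops" if "0 \<le> t" for t
    using that by (intro ptensor_map_bounded_ops T_op V_op)
  show "ptensor_map (T 0) (V 0) = id_blinfun"
    by (rule ptensor_eqI) (simp add: tprod C0_semigroup_0[OF T] C0_semigroup_0[OF V])
  show "ptensor_map (T (s + t)) (V (s + t)) = ptensor_map (T s) (V s) o\<^sub>L ptensor_map (T t) (V t)"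
    if "0 \<le> s" "0 \<le> t" for s t
    by (rule ptensor_eqI)
      (simp add: that tprod C0_semigroup_add[OF T] C0_semigroup_add[OF V])
  obtain M N where M: "M > 0" "\<forall>\<^sub>F t in at_right 0. norm (T t) \<le> M"
    and N: "N > 0" "\<forall>\<^sub>F t in at_right 0. norm (V t) \<le> N"
    using C0_semigroup_bounded_near_0[OF T] C0_semigroup_bounded_near_0[OF V] by metis
  show "((\<lambda>t. ptensor_map (T t) (V t) z) \<longlongrightarrow> z) (at_right 0)" for z
  proof (rule tendsto_blinfun_closure)
    show "\<forall>\<^sub>F t in at_right 0. norm (ptensor_map (T t) (V t)) \<le> M * N"
      \<comment> \<open>The facts on \<open>ptensor_map\<close> need \<open>T t\<close> and
        \<open>V t\<close> in \<open>bounded_ops\<close>, known for \<open>t \<ge> 0\<close> only;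
        this holds eventually in \<open>at_right 0\<close>. The same restriction enters in the
        elementary tensor case below.\<close>
      using M(2) N(2) eventually_at_right_less[of 0]
    proof eventually_elim
      case (elim t)
      have "norm (ptensor_map (T t) (V t)) \<le> norm (T t) * norm (V t)"
        using elim(3) by (intro norm_ptensor_map T_op V_op) simp_all
      also have "\<dots> \<le> M * N" using elim M by (intro mult_mono) auto
      finally show ?case .
    qed
    show "z \<in> closure (range of_tensor)" by (simp add: of_tensor_dense)
    fix w :: "'a ptensor" assume "w \<in> range of_tensor"
    then obtain \<rho> where w: "w = of_tensor \<rho>" by blast
    show "((\<lambda>t. ptensor_map (T t) (V t) w) \<longlongrightarrow> w) (at_right 0)"
      unfolding w
    proof (induction \<rho> rule: tensor_induct)
      case zero
      then show ?case by (simp add: linear_0[OF linear_of_tensor])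
    next
      case (tprod x y)
      have "((\<lambda>t. of_tensor (T t x \<otimes> V t y)) \<longlongrightarrow> of_tensor (x \<otimes> y)) (at_right 0)"
        by (intro bounded_bilinear.tendsto[OF bounded_bilinear_tprod] C0_semigroup_tendsto T V)
      then show ?case
        by (rule Lim_transform_eventually)
          (use eventually_at_right_less[of 0] in eventually_elim,
            simp add: ptensor_map_tprod T_op V_op)
    next
      case (add \<rho> \<sigma>)
      then show ?case by (simp add: of_tensor_add blinfun.add_right tendsto_add)
    qed
  qed
qed

section \<open>The implemented semigroup and its pre-dual\<close>

lemma implemented_apply: "implemented T V t P x y = P (T t x) (V t y)"
  by (simp add: implemented_def dual_op_apply)

lemma implemented_ops_to_dual:
  assumes T: "T t \<in> bounded_ops" and V: "V t \<in> bounded_ops" and P: "P \<in> ops_to_dual"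
  shows "implemented T V t P \<in> ops_to_dual"
  using assms unfolding ops_to_dual_def dual_space_def bounded_ops_def
  by (simp add: implemented_apply)

text \<open>On \<open>x \<otimes> y\<close> both functionals take the value
  \<open>P (T t x) (V t y)\<close>, and a functional with the values of an element of
  \<open>ops_to_dual\<close> on elementary tensors is its \<open>tensor_functional\<close>.\<close>

lemma is_adjoint_implemented:
  assumes T: "T t \<in> bounded_ops" and V: "V t \<in> bounded_ops"
  shows "is_adjoint (implemented T V t) (ptensor_map (T t) (V t))"
  unfolding is_adjoint_def
proof (intro ballI conjI)
  fix P :: "'a \<Rightarrow>\<^sub>L 'a \<Rightarrow>\<^sub>L complex" assume P: "P \<in> ops_to_dual"
  show "implemented T V t P \<in> ops_to_dual" by (rule implemented_ops_to_dual[of T t V, OF T V P])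
  then show "tensor_functional (implemented T V t P)
      = dual_op (ptensor_map (T t) (V t)) (tensor_functional P)"
    by (rule tensor_functional_eqI)
      (simp add: dual_op_apply ptensor_map_tprod[OF T V] tensor_functional(2)[OF P]
        implemented_apply)
qed

lemma C0star_semigroup_implemented:
  assumes T: "C0_semigroup T" and V: "C0_semigroup V"
  shows "C0star_semigroup (implemented T V)"
proof -
  let ?S = "\<lambda>t. ptensor_map (T t) (V t)"
  have S: "C0_semigroup ?S" by (rule C0_semigroup_ptensor_map[OF T V])
  have adj: "is_adjoint (implemented T V t) (?S t)" if "0 \<le> t" for t
    by (intro is_adjoint_implemented C0_semigroup_bounded_ops[OF T that]
        C0_semigroup_bounded_ops[OF V that])
  show ?thesis
    unfolding C0star_semigroup_def
  proof (intro conjI allI impI ballI)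
    show "implemented T V t P \<in> ops_to_dual" if "0 \<le> t" "P \<in> ops_to_dual" for t P
      using adj[OF that(1)] that(2) unfolding is_adjoint_def by blast
    show "implemented T V 0 P = P" for P
      by (intro blinfun_eqI)
        (simp add: implemented_apply C0_semigroup_0[OF T] C0_semigroup_0[OF V])
    \<comment> \<open>Composition reverses the order: the right side evaluates to
      \<open>P (T t (T s x)) (V t (V s y))\<close>, so the semigroup law is needed for
      \<open>t + s\<close>, hence the commuted sum.\<close>
    show "implemented T V (s + t) P = implemented T V s (implemented T V t P)"
      if "0 \<le> s" "0 \<le> t" for s t P
      by (intro blinfun_eqI)
        (simp add: implemented_apply add.commute[of s] that C0_semigroup_add[OF T]
          C0_semigroup_add[OF V])
    show "continuous_on {0..} (\<lambda>t. tensor_functional (implemented T V t P) \<rho>)"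
      if P: "P \<in> ops_to_dual" for P \<rho>
    proof -
      \<comment> \<open>For \<open>t \<ge> 0\<close> adjointness moves the time dependence from
        \<open>P\<close> to the orbit of \<open>\<rho>\<close>, which is norm continuous.\<close>
      have "continuous_on {0..} (\<lambda>t. tensor_functional P (?S t \<rho>))"
        by (intro continuous_intros C0_semigroup_continuous_on[OF S])
      then show ?thesis
        by (rule continuous_on_eq) (use adj P in \<open>auto simp: is_adjoint_def dual_op_apply\<close>)
    qed
    show "\<exists>S. C0_semigroup S \<and> (\<forall>t\<ge>0. is_adjoint (implemented T V t) (S t))"
      using S adj by blast
  qed
qed

text \<open>One witness \<open>S\<close> serves all conjuncts. \<open>C0star_semigroup\<close>
  asserts only that some pre-dual semigroup exists; the last conjunct says that it can be taken to
  be the extension of the algebraic tensor product semigroup.\<close>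

theorem theorem4:
  fixes T V :: "real \<Rightarrow> 'a::rc_banach \<Rightarrow>\<^sub>L 'a"
  assumes "C0_semigroup T" and "C0_semigroup V"
  shows "\<exists>S :: real \<Rightarrow> 'a ptensor \<Rightarrow>\<^sub>L 'a ptensor.
    C0_semigroup S \<and>
    (\<forall>t\<ge>0. \<forall>\<rho>. S t (of_tensor \<rho>) = of_tensor (tensor_map (T t) (V t) \<rho>)) \<and>
    C0star_semigroup (implemented T V) \<and>
    (\<forall>t\<ge>0. is_adjoint (implemented T V t) (S t))"
proof (intro exI[of _ "\<lambda>t. ptensor_map (T t) (V t)"] conjI allI impI)
  note op = C0_semigroup_bounded_ops[OF assms(1)] C0_semigroup_bounded_ops[OF assms(2)]
  show "C0_semigroup (\<lambda>t. ptensor_map (T t) (V t))" by (rule C0_semigroup_ptensor_map[OF assms])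
  show "C0star_semigroup (implemented T V)" by (rule C0star_semigroup_implemented[OF assms])
  fix t :: real assume t: "0 \<le> t"
  show "ptensor_map (T t) (V t) (of_tensor \<rho>) = of_tensor (tensor_map (T t) (V t) \<rho>)" for \<rho>
    by (rule ptensor_map_of_tensor[OF op[OF t]])
  show "is_adjoint (implemented T V t) (ptensor_map (T t) (V t))"
    by (rule is_adjoint_implemented[of T t V, OF op[OF t]])
qed

end
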